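(* Let $F$ be a forest. Then (1) the star ideal $F^\star$ is simple; (2) the dominance complex $R(F^\star)$ collapses onto (a subcomplex isomorphic to) the boundary of a cross-polytope of dimension $d(F^\star)$; (3) $\beta_1(F)=\alpha_0(F)=d(F^\star)$.
   Context: For a graph $G$ on vertices $X=\{x_1,\ldots,x_n\}$, the star ideal $G^\star\subset\mathbb{Z}[X]$ is generated by $x_1^2,\ldots,x_n^2$ and the monomials $\prod_{x\in N[x_i]}x$, $i=1,\ldots,n$, where $N[x_i]$ is the closed neighbourhood; $R(G^\star)$ is the dominance complex. $\beta_1$ is the matching number (maximum number of pairwise disjoint edges) and $\alpha_0$ the vertex covering number (minimum size of a set of vertices meeting every edge). For a monomial ideal $I$ containing all $x_i^2$: $R(I)$ is the simplicial complex of monomials not in $I$; $(I:x)=\{m:xm\in I\}$; $R(I)$ is a cone with apex $a$ if $(I:a)=(I,a)$; $a$ dominates $b$ in $I$ if $R(I)$ is not a cone with apex $b$ but $R((I,a))$ is. A sequence $(a_1,\ldots,a_r)$ of variables with $I_i=(I:a_1\cdots a_{i-1})$, $i\in[r+1]$, is a resolution if for all $i\in[r]$, $a_i\notin I_i$ and either $R(I_i)$ is a cone with apex $a_i$ or $a_i$ dominates some variable in $I_i$; maximal if not extendable; its core is $I_{r+1}$ and depth $r$; $d(I)$ is the minimum depth of a maximal resolution; $I$ is simple if $(x_1,\ldots,x_n)$ is the core of some maximal resolution (ideals being identified with their extensions by extra variables). An elementary collapse removes a maximal face $\sigma$ and a face $\tau\subset\sigma$ of one less degree such that $\sigma$ is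 the only face properly containing $\tau$; collapsing means a sequence of these. The boundary of the $d$-dimensional cross-polytope is $R\bigl((y_1y_2,\ldots,y_{2d-1}y_{2d},y_1^2,\ldots,y_{2d}^2)\bigr)$. *)

theory Defs
  imports "HOL-Algebra.Ideal" "HOL-Library.Poly_Mapping" "HOL-Library.Disjoint_Sets"
begin

text \<open>
  Monomials in variables from \<^typ>\<open>'a\<close> are exponent vectors (written additively), and integer
  polynomials are finitely supported functions from monomials to \<^typ>\<open>int\<close>. The type
  \<open>'a\<close> may contain more elements than the variables in play, so the ring
  \<open>\<int>[X]\<close> is given by an explicit carrier and a finite variable set \<open>X\<close>.
\<close>

type_synonym 'a mon = "'a \<Rightarrow>\<^sub>0 nat"
type_synonym 'a int_mpoly = "'a mon \<Rightarrow>\<^sub>0 int"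

definition mon_poly :: "'a mon \<Rightarrow> 'a int_mpoly" where
  "mon_poly m = Poly_Mapping.single m 1"

definition Var :: "'a \<Rightarrow> 'a int_mpoly" where
  "Var x = mon_poly (Poly_Mapping.single x 1)"

definition int_poly_ring :: "'a set \<Rightarrow> 'a int_mpoly ring" where
  "int_poly_ring X = \<lparr>carrier = {p. \<forall>m \<in> Poly_Mapping.keys p. Poly_Mapping.keys m \<subseteq> X},
           mult = (*), one = 1, zero = 0, add = (+)\<rparr>"

lemma int_poly_ring_add_closed:
  assumes "p \<in> carrier (int_poly_ring X)" "q \<in> carrier (int_poly_ring X)"
  shows "p + q \<in> carrier (int_poly_ring X)"
  using assms subsetD[OF keys_add[of p q]] unfolding int_poly_ring_def by auto

lemma int_poly_ring_mult_closed:
  assumes "p \<in> carrier (int_poly_ring X)" "q \<in> carrier (int_poly_ring X)"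
  shows "p * q \<in> carrier (int_poly_ring X)"
proof -
  have "Poly_Mapping.keys m \<subseteq> X" if m: "m \<in> Poly_Mapping.keys (p * q)" for m
  proof -
    obtain a b where "m = a + b" "a \<in> Poly_Mapping.keys p" "b \<in> Poly_Mapping.keys q"
      using subsetD[OF keys_mult m] by auto
    then show ?thesis
      using assms keys_add[of a b] unfolding int_poly_ring_def by simp blast
  qed
  then show ?thesis by (simp add: int_poly_ring_def)
qed

lemma cring_int_poly_ring: "cring (int_poly_ring X)"
proof (rule cringI)
  show "abelian_group (int_poly_ring X)"
  proof (rule abelian_groupI)
    fix p assume "p \<in> carrier (int_poly_ring X)"
    then show "\<exists>q \<in> carrier (int_poly_ring X). q \<oplus>\<^bsub>int_poly_ring X\<^esub> p = \<zero>\<^bsub>int_poly_ring X\<^esub>"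
      by (intro bexI[of _ "- p"]) (simp_all add: int_poly_ring_def)
  next
    fix p q assume "p \<in> carrier (int_poly_ring X)" "q \<in> carrier (int_poly_ring X)"
    from int_poly_ring_add_closed[OF this]
    show "p \<oplus>\<^bsub>int_poly_ring X\<^esub> q \<in> carrier (int_poly_ring X)"
      by (simp add: int_poly_ring_def)
  qed (simp_all add: int_poly_ring_def ac_simps)
  show "comm_monoid (int_poly_ring X)"
  proof (rule comm_monoidI)
    fix p q assume "p \<in> carrier (int_poly_ring X)" "q \<in> carrier (int_poly_ring X)"
    from int_poly_ring_mult_closed[OF this]
    show "p \<otimes>\<^bsub>int_poly_ring X\<^esub> q \<in> carrier (int_poly_ring X)"
      by (simp add: int_poly_ring_def)
  qed (simp_all add: int_poly_ring_def ac_simps)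
qed (simp add: int_poly_ring_def distrib_right)


definition mon_dvd :: "'a mon \<Rightarrow> 'a mon \<Rightarrow> bool" where
  "mon_dvd m n \<longleftrightarrow> (\<exists>k. n = m + k)"

definition mon_degree :: "'a mon \<Rightarrow> nat" where
  "mon_degree m = (\<Sum>x \<in> Poly_Mapping.keys m. Poly_Mapping.lookup m x)"

definition complex_of :: "'a set \<Rightarrow> 'a int_mpoly set \<Rightarrow> 'a mon set" where
  "complex_of X I = {m. Poly_Mapping.keys m \<subseteq> X \<and> mon_poly m \<notin> I}"

definition colon :: "'a set \<Rightarrow> 'a int_mpoly set \<Rightarrow> 'a int_mpoly \<Rightarrow> 'a int_mpoly set" where
  "colon X I p = {q \<in> carrier (int_poly_ring X). p * q \<in> I}"

definition adjoin :: "'a set \<Rightarrow> 'a int_mpoly set \<Rightarrow> 'a int_mpoly \<Rightarrow> 'a int_mpoly set" where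
  "adjoin X I p = Idl\<^bsub>int_poly_ring X\<^esub> (insert p I)"

definition is_cone :: "'a set \<Rightarrow> 'a int_mpoly set \<Rightarrow> 'a \<Rightarrow> bool" where
  "is_cone X I a \<longleftrightarrow> colon X I (Var a) = adjoin X I (Var a)"

definition dominates :: "'a set \<Rightarrow> 'a int_mpoly set \<Rightarrow> 'a \<Rightarrow> 'a \<Rightarrow> bool" where
  "dominates X I a b \<longleftrightarrow> \<not> is_cone X I b \<and> is_cone X (adjoin X I (Var a)) b"


definition colon_seq :: "'a set \<Rightarrow> 'a int_mpoly set \<Rightarrow> 'a list \<Rightarrow> 'a int_mpoly set" where
  "colon_seq X I as = colon X I (\<Prod>a\<leftarrow>as. Var a)"

text \<open>With list positions starting at 0, the ideal seen by \<open>as ! i\<close> is the colon by the product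
  of the first \<open>i\<close> entries.\<close>

definition resolution :: "'a set \<Rightarrow> 'a int_mpoly set \<Rightarrow> 'a list \<Rightarrow> bool" where
  "resolution X I as \<longleftrightarrow> set as \<subseteq> X \<and>
     (\<forall>i < length as.
        Var (as ! i) \<notin> colon_seq X I (take i as) \<and>
        (is_cone X (colon_seq X I (take i as)) (as ! i) \<or>
         (\<exists>b \<in> X. dominates X (colon_seq X I (take i as)) (as ! i) b)))"

definition maximal_resolution :: "'a set \<Rightarrow> 'a int_mpoly set \<Rightarrow> 'a list \<Rightarrow> bool" where
  "maximal_resolution X I as \<longleftrightarrow> resolution X I as \<and> \<not> (\<exists>a. resolution X I (as @ [a]))"

text \<open>The core of a resolution \<open>as\<close> is \<open>colon_seq X I as\<close> and its depth is \<open>length as\<close>. The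
  entries of a resolution are distinct because \<open>I\<close> contains the squares of the variables, so
  for finite \<open>X\<close> maximal resolutions exist and the minimum below is attained.\<close>

definition resolution_depth :: "'a set \<Rightarrow> 'a int_mpoly set \<Rightarrow> nat" where
  "resolution_depth X I = (LEAST r. \<exists>as. maximal_resolution X I as \<and> length as = r)"

definition simple_ideal :: "'a set \<Rightarrow> 'a int_mpoly set \<Rightarrow> bool" where
  "simple_ideal X I \<longleftrightarrow>
     (\<exists>as. maximal_resolution X I as \<and> colon_seq X I as = Idl\<^bsub>int_poly_ring X\<^esub> (Var ` X))"


definition elementary_collapse :: "'a mon set \<Rightarrow> 'a mon set \<Rightarrow> bool" where
  "elementary_collapse \<Delta> \<Delta>' \<longleftrightarrow>
     (\<exists>\<sigma> \<in> \<Delta>. \<exists>\<tau> \<in> \<Delta>.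
        (\<forall>\<rho> \<in> \<Delta>. mon_dvd \<sigma> \<rho> \<longrightarrow> \<rho> = \<sigma>) \<and>
        mon_dvd \<tau> \<sigma> \<and> mon_degree \<sigma> = mon_degree \<tau> + 1 \<and>
        (\<forall>\<rho> \<in> \<Delta>. mon_dvd \<tau> \<rho> \<and> \<rho> \<noteq> \<tau> \<longrightarrow> \<rho> = \<sigma>) \<and>
        \<Delta>' = \<Delta> - {\<sigma>, \<tau>})"

definition collapses_onto :: "'a mon set \<Rightarrow> 'a mon set \<Rightarrow> bool" where
  "collapses_onto = elementary_collapse\<^sup>*\<^sup>*"

definition complex_vertices :: "'a mon set \<Rightarrow> 'a set" where
  "complex_vertices \<Delta> = {x. Poly_Mapping.single x 1 \<in> \<Delta>}"

definition rename_mon :: "('a \<Rightarrow> 'b) \<Rightarrow> 'a mon \<Rightarrow> 'b mon" where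
  "rename_mon f m = (\<Sum>x \<in> Poly_Mapping.keys m. Poly_Mapping.single (f x) (Poly_Mapping.lookup m x))"

definition complex_iso :: "'a mon set \<Rightarrow> 'b mon set \<Rightarrow> bool" where
  "complex_iso \<Delta> \<Gamma> \<longleftrightarrow>
     (\<exists>f. bij_betw f (complex_vertices \<Delta>) (complex_vertices \<Gamma>) \<and> rename_mon f ` \<Delta> = \<Gamma>)"

definition cross_polytope_boundary :: "nat \<Rightarrow> nat mon set" where
  "cross_polytope_boundary d = complex_of {1..2*d}
     (Idl\<^bsub>int_poly_ring {1..2*d}\<^esub> ((\<lambda>i. Var (2*i - 1) * Var (2*i)) ` {1..d} \<union> (\<lambda>j. (Var j)\<^sup>2) ` {1..2*d}))"


definition simple_graph :: "'a set \<Rightarrow> 'a set set \<Rightarrow> bool" where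
  "simple_graph V E \<longleftrightarrow> finite V \<and> (\<forall>e \<in> E. e \<subseteq> V \<and> card e = 2)"

definition graph_cycle :: "'a set set \<Rightarrow> 'a list \<Rightarrow> bool" where
  "graph_cycle E vs \<longleftrightarrow> length vs \<ge> 3 \<and> distinct vs \<and>
     (\<forall>i < length vs. {vs ! i, vs ! (Suc i mod length vs)} \<in> E)"

definition forest :: "'a set \<Rightarrow> 'a set set \<Rightarrow> bool" where
  "forest V E \<longleftrightarrow> simple_graph V E \<and> \<not> (\<exists>vs. graph_cycle E vs)"

definition closed_nbhd :: "'a set set \<Rightarrow> 'a \<Rightarrow> 'a set" where
  "closed_nbhd E v = insert v {u. {u, v} \<in> E}"

definition star_ideal :: "'a set \<Rightarrow> 'a set set \<Rightarrow> 'a int_mpoly set" where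
  "star_ideal V E = Idl\<^bsub>int_poly_ring V\<^esub>
     ((\<lambda>x. (Var x)\<^sup>2) ` V \<union> (\<lambda>x. \<Prod>y \<in> closed_nbhd E x. Var y) ` V)"

definition matching_number :: "'a set set \<Rightarrow> nat" where
  "matching_number E = Max (card ` {M. M \<subseteq> E \<and> disjoint M})"

definition vertex_cover_number :: "'a set \<Rightarrow> 'a set set \<Rightarrow> nat" where
  "vertex_cover_number V E = Min (card ` {C. C \<subseteq> V \<and> (\<forall>e \<in> E. e \<inter> C \<noteq> {})})"

end

theory Submission
  imports Defs "HOL-Combinatorics.Transposition"
begin

text \<open>
  An ideal containing the squares of the variables is encoded by its family of squarefree standard
  monomials; colon and adjunction of a variable become link and deletion. If \<open>l\<close> is a leaf of a
  forest with neighbour \<open>p\<close>, then \<open>p\<close> dominates \<open>l\<close>, the product \<open>l p\<close> lies in the star ideal, and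
  the link of \<open>p\<close> in the dominance complex is the dominance complex of the forest with the edges
  at \<open>p\<close> removed (the generator \<open>N[p]\<close> becomes redundant because of \<open>l\<close>, and the variable \<open>p\<close> is
  absorbed as an isolated vertex). Iterating until no edge is left exhibits a maximal resolution
  whose core is generated by the variables. The edges \<open>{l, p}\<close> form a matching and the vertices
  \<open>p\<close> a vertex cover of the same size, the number of steps. Each step is a suspension up to
  collapses, which yields the cross-polytope. A diamond argument shows that every maximal
  resolution of such a complex has the same depth.
\<close>

section \<open>Iterated suspensions\<close>

text \<open>Both the void family and \<open>{{}}\<close> qualify. Under the dictionary between
  ideals and families of faces they stand for the unit ideal and for the ideal generated by all
  variables.\<close>

definition simplicial :: "'a set set \<Rightarrow> bool" where
  "simplicial \<Delta> \<longleftrightarrow> (\<forall>\<sigma>\<in>\<Delta>. finite \<sigma> \<and> (\<forall>\<tau>\<subseteq>\<sigma>. \<tau> \<in> \<Delta>))"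

definition link :: "'a set set \<Rightarrow> 'a \<Rightarrow> 'a set set" where
  "link \<Delta> a = {\<sigma>. a \<notin> \<sigma> \<and> insert a \<sigma> \<in> \<Delta>}"

definition deletion :: "'a set set \<Rightarrow> 'a \<Rightarrow> 'a set set" where
  "deletion \<Delta> a = {\<sigma> \<in> \<Delta>. a \<notin> \<sigma>}"

definition cone_apex :: "'a set set \<Rightarrow> 'a \<Rightarrow> bool" where
  "cone_apex \<Delta> a \<longleftrightarrow> (\<forall>\<sigma>\<in>\<Delta>. insert a \<sigma> \<in> \<Delta>)"

lemma simplicialD: "simplicial \<Delta> \<Longrightarrow> \<sigma> \<in> \<Delta> \<Longrightarrow> \<tau> \<subseteq> \<sigma> \<Longrightarrow> \<tau> \<in> \<Delta>"
  by (auto simp: simplicial_def)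

lemma simplicial_link: "simplicial \<Delta> \<Longrightarrow> simplicial (link \<Delta> a)"
  unfolding simplicial_def link_def
proof (intro ballI conjI allI impI; clarify)
  fix \<sigma> \<tau> assume *: "\<forall>\<sigma>\<in>\<Delta>. finite \<sigma> \<and> (\<forall>\<tau>\<subseteq>\<sigma>. \<tau> \<in> \<Delta>)" "insert a \<sigma> \<in> \<Delta>" "a \<notin> \<sigma>"
  show "finite \<sigma>" using * by (metis finite_insert)
  assume "\<tau> \<subseteq> \<sigma>"
  then show "a \<notin> \<tau> \<and> insert a \<tau> \<in> \<Delta>" using * by (meson insert_mono subsetD)
qed

lemma simplicial_deletion: "simplicial \<Delta> \<Longrightarrow> simplicial (deletion \<Delta> a)"
  unfolding simplicial_def deletion_def by auto

lemma link_subset: "simplicial \<Delta> \<Longrightarrow> link \<Delta> a \<subseteq> deletion \<Delta> a"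
  by (auto simp: link_def deletion_def intro: simplicialD)

lemma link_commute: "a \<noteq> b \<Longrightarrow> link (link \<Delta> a) b = link (link \<Delta> b) a"
  by (auto simp: link_def insert_commute)

text \<open>The definition of \<open>is_cone\<close> compares a colon with an adjunction, which
  become link and deletion. One inclusion always holds, so equality amounts to closure under
  inserting the apex.\<close>

lemma cone_apex_iff:
  assumes "simplicial \<Delta>"
  shows "cone_apex \<Delta> a \<longleftrightarrow> link \<Delta> a = deletion \<Delta> a"
proof
  assume "cone_apex \<Delta> a"
  then show "link \<Delta> a = deletion \<Delta> a"
    using link_subset[OF assms] by (auto simp: cone_apex_def link_def deletion_def)
next
  assume eq: "link \<Delta> a = deletion \<Delta> a"
  have "insert a \<sigma> \<in> \<Delta>" if "\<sigma> \<in> \<Delta>" for \<sigma>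
  proof (cases "a \<in> \<sigma>")
    case False
    then have "\<sigma> \<in> link \<Delta> a" using that eq by (auto simp: deletion_def)
    then show ?thesis by (simp add: link_def)
  qed (use that in \<open>simp add: insert_absorb\<close>)
  then show "cone_apex \<Delta> a" by (simp add: cone_apex_def)
qed

text \<open>The condition \<open>{a, b} \<notin> \<Delta>\<close> makes \<open>\<Delta>\<close> the suspension of the link of \<open>a\<close> with poles \<open>a\<close> and \<open>b\<close>, up to a collapse of the cone with
  apex \<open>b\<close>.\<close>

inductive iterated_suspension :: "'a set set \<Rightarrow> nat \<Rightarrow> bool" where
  base: "iterated_suspension {{}} 0"
| step: "{a} \<in> \<Delta> \<Longrightarrow> {a, b} \<notin> \<Delta> \<Longrightarrow> cone_apex (deletion \<Delta> a) b \<Longrightarrow>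
    iterated_suspension (link \<Delta> a) d \<Longrightarrow> iterated_suspension \<Delta> (Suc d)"

lemma iterated_suspension_0: "iterated_suspension \<Delta> 0 \<longleftrightarrow> \<Delta> = {{}}"
  by (auto elim: iterated_suspension.cases intro: iterated_suspension.base)

lemma cone_deletionD: "cone_apex (deletion \<Delta> a) b \<Longrightarrow> \<sigma> \<in> \<Delta> \<Longrightarrow> a \<notin> \<sigma> \<Longrightarrow> insert b \<sigma> \<in> \<Delta> \<and> a \<noteq> b"
  by (auto simp: cone_apex_def deletion_def)

lemma cone_deletionI:
  "a \<noteq> b \<Longrightarrow> (\<And>\<sigma>. \<sigma> \<in> \<Delta> \<Longrightarrow> a \<notin> \<sigma> \<Longrightarrow> insert b \<sigma> \<in> \<Delta>) \<Longrightarrow> cone_apex (deletion \<Delta> a) b"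
  by (auto simp: cone_apex_def deletion_def)

text \<open>Starting from a face that avoids \<open>a\<close>, drop \<open>b\<close>, insert
  \<open>c\<close>, then put \<open>b\<close> back. The set still avoids \<open>a\<close> because
  \<open>a \<noteq> c\<close>, and the desired face is a subset of the result.\<close>

lemma cone_deletion_trans:
  assumes "simplicial \<Delta>" "cone_apex (deletion \<Delta> a) b" "cone_apex (deletion \<Delta> b) c" "a \<noteq> c"
  shows "cone_apex (deletion \<Delta> a) c"
proof (rule cone_deletionI[OF assms(4)])
  fix \<sigma> assume \<sigma>: "\<sigma> \<in> \<Delta>" "a \<notin> \<sigma>"
  have "insert c (\<sigma> - {b}) \<in> \<Delta>"
    using cone_deletionD[OF assms(3), of "\<sigma> - {b}"] simplicialD[OF assms(1) \<sigma>(1)] by blast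
  then have "insert b (insert c (\<sigma> - {b})) \<in> \<Delta>"
    using cone_deletionD[OF assms(2)] \<sigma>(2) assms(4) by blast
  then show "insert c \<sigma> \<in> \<Delta>" by (rule simplicialD[OF assms(1)]) auto
qed

text \<open>A face of the link of \<open>c\<close> is enlarged by \<open>c\<close> before the cone
  property is used. The enlarged face still avoids \<open>a\<close>, so the pair \<open>a\<close>,
  \<open>b\<close> keeps its role in the link of a third vertex.\<close>

lemma cone_deletion_link:
  assumes "cone_apex (deletion \<Delta> a) b" "a \<noteq> c" "b \<noteq> c" "a \<noteq> b"
  shows "cone_apex (deletion (link \<Delta> c) a) b"
proof (rule cone_deletionI[OF assms(4)])
  fix \<sigma> assume \<sigma>: "\<sigma> \<in> link \<Delta> c" "a \<notin> \<sigma>"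
  then have "insert b (insert c \<sigma>) \<in> \<Delta>"
    using cone_deletionD[OF assms(1), of "insert c \<sigma>"] assms(2) by (auto simp: link_def)
  then show "insert b \<sigma> \<in> link \<Delta> c"
    using \<sigma> assms(3) by (auto simp: link_def insert_commute)
qed

text \<open>The combinatorial form of the fact that a sphere is not contractible. It excludes the
  cone alternative in the definition of a resolution, so that every step is a domination. An apex
  \<open>a\<close> would join the poles \<open>a\<close> and \<open>b\<close>; any other apex would
  be an apex of the link of \<open>a\<close>.\<close>

lemma iterated_suspension_not_cone:
  "iterated_suspension \<Delta> d \<Longrightarrow> simplicial \<Delta> \<Longrightarrow> \<not> cone_apex \<Delta> c"
proof (induction rule: iterated_suspension.induct)
  case base
  then show ?case by (auto simp: cone_apex_def)
next
  case (step a \<Delta> b d)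
  show ?case
  proof
    assume c: "cone_apex \<Delta> c"
    have "{} \<in> \<Delta>" using simplicialD[OF step.prems step.hyps(1)] by simp
    then have b: "{b} \<in> \<Delta>" using cone_deletionD[OF step.hyps(3)] by simp
    show False
    proof (cases "c = a")
      case True
      then show ?thesis using c b step.hyps(2) by (auto simp: cone_apex_def)
    next
      case False
      then have "cone_apex (link \<Delta> a) c"
        using c by (auto simp: cone_apex_def link_def insert_commute)
      then show ?thesis using step.IH simplicial_link[OF step.prems] by blast
    qed
  qed
qed

section \<open>Transport along injections and exchange of suspension steps\<close>

lemma inj_image: "inj f \<Longrightarrow> inj ((`) f)"
  by (simp add: inj_def inj_image_eq_iff)

lemma image_link:
  assumes "inj f"
  shows "(`) f ` link \<Delta> a = link ((`) f ` \<Delta>) (f a)"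
proof (intro subset_antisym subsetI)
  fix \<sigma> assume "\<sigma> \<in> (`) f ` link \<Delta> a"
  then show "\<sigma> \<in> link ((`) f ` \<Delta>) (f a)"
    using inj_image_mem_iff[OF assms] by (auto simp: link_def simp flip: image_insert)
next
  fix \<sigma> assume \<sigma>: "\<sigma> \<in> link ((`) f ` \<Delta>) (f a)"
  then obtain \<tau> where \<tau>: "\<tau> \<in> \<Delta>" "insert (f a) \<sigma> = f ` \<tau>" by (auto simp: link_def)
  have "a \<in> \<tau>" using \<tau>(2) inj_image_mem_iff[OF assms] by blast
  moreover have "\<sigma> = f ` (\<tau> - {a})"
    using \<tau>(2) \<sigma> by (auto simp: link_def image_set_diff[OF assms])
  ultimately show "\<sigma> \<in> (`) f ` link \<Delta> a"
    using \<tau>(1) by (auto simp: link_def insert_absorb)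
qed

lemma iterated_suspension_image:
  assumes "inj f" "iterated_suspension \<Delta> d"
  shows "iterated_suspension ((`) f ` \<Delta>) d"
  using assms(2)
proof (induction rule: iterated_suspension.induct)
  case base
  then show ?case by (simp add: iterated_suspension.base)
next
  case (step a \<Delta> b d)
  show ?case
  proof (rule iterated_suspension.step[of "f a" _ "f b"])
    show "{f a} \<in> (`) f ` \<Delta>" using step.hyps(1) by (metis image_empty image_eqI image_insert)
    show "{f a, f b} \<notin> (`) f ` \<Delta>"
    proof
      assume "{f a, f b} \<in> (`) f ` \<Delta>"
      then have "f ` {a, b} \<in> (`) f ` \<Delta>" by simp
      then have "{a, b} \<in> \<Delta>" by (simp only: inj_image_mem_iff[OF inj_image[OF assms(1)]])
      then show False using step.hyps(2) by blast
    qed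
    show "cone_apex (deletion ((`) f ` \<Delta>) (f a)) (f b)"
      unfolding cone_apex_def
    proof
      fix \<sigma> assume "\<sigma> \<in> deletion ((`) f ` \<Delta>) (f a)"
      then obtain \<tau> where \<tau>: "\<sigma> = f ` \<tau>" "\<tau> \<in> deletion \<Delta> a" by (auto simp: deletion_def)
      then have "insert b \<tau> \<in> deletion \<Delta> a" using step.hyps(3) by (simp add: cone_apex_def)
      then have "f ` insert b \<tau> \<in> deletion ((`) f ` \<Delta>) (f a)"
        using inj_image_mem_iff[OF assms(1), of a "insert b \<tau>"] unfolding deletion_def
        by (simp del: image_insert)
      then show "insert (f b) \<sigma> \<in> deletion ((`) f ` \<Delta>) (f a)" by (simp add: \<tau>)
    qed
    show "iterated_suspension (link ((`) f ` \<Delta>) (f a)) d"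
      using step.IH by (simp add: image_link[OF assms(1)])
  qed
qed

text \<open>A face with exactly one of the two vertices may exchange it for the other: remove the
  one, then insert the apex of the deletion. All other faces are fixed by the transposition, and
  being an involution it maps onto \<open>\<Delta>\<close>.\<close>

lemma twins_transpose:
  assumes "simplicial \<Delta>" "cone_apex (deletion \<Delta> a) b" "cone_apex (deletion \<Delta> b) a"
  shows "(`) (Transposition.transpose a b) ` \<Delta> = \<Delta>"
proof -
  let ?t = "Transposition.transpose a b"
  have t: "?t ` \<sigma> \<in> \<Delta>" if "\<sigma> \<in> \<Delta>" for \<sigma>
  proof (cases "a \<in> \<sigma> \<longleftrightarrow> b \<in> \<sigma>")
    case True
    then show ?thesis using that by (simp add: transpose_image_eq)
  next
    case False
    have "insert b (\<sigma> - {a}) \<in> \<Delta>" "insert a (\<sigma> - {b}) \<in> \<Delta>"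
      using cone_deletionD[OF assms(2), of "\<sigma> - {a}"] cone_deletionD[OF assms(3), of "\<sigma> - {b}"]
        simplicialD[OF assms(1) that] by auto
    moreover have "?t ` \<sigma> = insert b (\<sigma> - {a}) \<or> ?t ` \<sigma> = insert a (\<sigma> - {b})"
      using False by (auto simp: Transposition.transpose_def image_iff split: if_splits)
    ultimately show ?thesis by metis
  qed
  have "?t ` (?t ` \<sigma>) = \<sigma>" for \<sigma> by (simp add: image_image)
  then have "\<sigma> \<in> (`) ?t ` \<Delta>" if "\<sigma> \<in> \<Delta>" for \<sigma>
    using t[OF that] by (metis imageI)
  then show ?thesis using t by blast
qed

text \<open>Diamond argument: two
  domination steps by \<open>a\<close> and \<open>c\<close> commute, except when \<open>a\<close> and \<open>c\<close> dominate each other, and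
  then the transposition of \<open>a\<close> and \<open>c\<close> is a symmetry of \<open>\<Delta>\<close>.\<close>

lemma iterated_suspension_link:
  assumes "iterated_suspension \<Delta> e" "simplicial \<Delta>" "{c} \<in> \<Delta>"
    "cone_apex (deletion \<Delta> c) b'" "\<not> cone_apex \<Delta> b'"
  shows "\<exists>d. e = Suc d \<and> iterated_suspension (link \<Delta> c) d"
  using assms
proof (induction arbitrary: c b' rule: iterated_suspension.induct)
  case base
  then show ?case by auto
next
  case (step a \<Delta> b d)
  note simp = step.prems(1)
  have empty: "{} \<in> \<Delta>" using simplicialD[OF simp step.hyps(1)] by simp
  have ab: "a \<noteq> b" and cb': "c \<noteq> b'"
    using cone_deletionD[OF step.hyps(3) empty] cone_deletionD[OF step.prems(3) empty] by auto
  show ?case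
  proof (cases "a = c")
    case True
    then show ?thesis using step.hyps(4) by blast
  next
    case False
    show ?thesis
    proof (cases "b' = a \<and> b = c")
      case True
      \<comment> \<open>The swap carries the link of \<open>a\<close>, whose depth is known, to the
        link of \<open>c\<close>.\<close>
      have "inj (Transposition.transpose a c)" by (rule inj_transpose)
      from iterated_suspension_image[OF this step.hyps(4)]
      have "iterated_suspension (link ((`) (Transposition.transpose a c) ` \<Delta>) c) d"
        by (simp add: image_link[OF \<open>inj _\<close>])
      moreover have "(`) (Transposition.transpose a c) ` \<Delta> = \<Delta>"
        using twins_transpose[OF simp] True step.hyps(3) step.prems(3) by blast
      ultimately show ?thesis by simp
    next
      case not_twins: False
      \<comment> \<open>An apex different from \<open>a\<close> is sought, since only such an apex
        survives in the link of \<open>a\<close>. If \<open>b' = a\<close>, transitivity replaces it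
        by \<open>b\<close>, which differs from \<open>c\<close> outside the twin case.\<close>
      obtain b'' where b'': "b'' \<noteq> a" "cone_apex (deletion \<Delta> c) b''" "c \<noteq> b''"
      proof (cases "b' = a")
        case True
        then have "cone_apex (deletion \<Delta> c) b"
          using cone_deletion_trans[OF simp _ step.hyps(3)] step.prems(3) not_twins by blast
        then show ?thesis using that[of b] ab True not_twins by auto
      qed (use that step.prems(3) cb' in blast)
      have cone: "cone_apex (deletion (link \<Delta> a) c) b''"
        using cone_deletion_link b'' False by metis
      have not_cone_link: "\<not> cone_apex (link \<Delta> a) b''"
        using iterated_suspension_not_cone[OF step.hyps(4)] simplicial_link[OF simp] by blast
      show ?thesis
      proof (cases "{a, c} \<in> \<Delta>")
        case True
        then have "{c} \<in> link \<Delta> a" using False by (simp add: link_def)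
        from step.IH[OF simplicial_link[OF simp] this cone not_cone_link]
        obtain d' where d': "d = Suc d'" "iterated_suspension (link (link \<Delta> a) c) d'" by blast
        have bc: "b \<noteq> c" using True step.hyps(2) by blast
        \<comment> \<open>The two links are taken in the other order: the poles \<open>a\<close> and
          \<open>b\<close> of \<open>\<Delta>\<close> remain poles in the link of \<open>c\<close>,
          and below them lies the double link obtained from the induction hypothesis.\<close>
        have "iterated_suspension (link \<Delta> c) (Suc d')"
        proof (rule iterated_suspension.step[of a _ b])
          show "{a} \<in> link \<Delta> c" using True False by (simp add: link_def insert_commute)
          show "{a, b} \<notin> link \<Delta> c"
            using step.hyps(2) simplicialD[OF simp, of "insert c {a, b}" "{a, b}"]
            by (auto simp: link_def)
          show "cone_apex (deletion (link \<Delta> c) a) b"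
            using cone_deletion_link[OF step.hyps(3)] False bc ab by blast
          show "iterated_suspension (link (link \<Delta> c) a) d'"
            using d'(2) link_commute[OF False, of \<Delta>] by simp
        qed
        then show ?thesis using d'(1) by blast
      next
        case ac: False
        \<comment> \<open>If \<open>a\<close> and \<open>c\<close> do not span a face, deleting
          \<open>c\<close> leaves the link of \<open>a\<close> unchanged. That link would then be a
          cone with apex \<open>b''\<close>, which is impossible.\<close>
        have "c \<notin> \<sigma>" if "\<sigma> \<in> link \<Delta> a" for \<sigma>
        proof
          assume "c \<in> \<sigma>"
          then have "{a, c} \<in> \<Delta>"
            using that simplicialD[OF simp, of "insert a \<sigma>" "{a, c}"] by (simp add: link_def)
          then show False using ac by blast
        qed
        then have "deletion (link \<Delta> a) c = link \<Delta> a" by (auto simp: deletion_def)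
        then show ?thesis using cone not_cone_link by simp
      qed
    qed
  qed
qed

section \<open>Squarefree ideals and families of faces\<close>

lemma poly_mapping_sum_single:
  fixes p :: "'b \<Rightarrow>\<^sub>0 'c::comm_monoid_add"
  shows "p = (\<Sum>m\<in>Poly_Mapping.keys p. Poly_Mapping.single m (Poly_Mapping.lookup p m))"
proof (rule poly_mapping_eqI)
  fix k
  have "(\<Sum>m\<in>Poly_Mapping.keys p. Poly_Mapping.lookup (Poly_Mapping.single m (Poly_Mapping.lookup p m)) k)
      = (\<Sum>m\<in>Poly_Mapping.keys p. if m = k then Poly_Mapping.lookup p m else 0)"
    by (rule sum.cong) (auto simp: lookup_single when_def)
  then show "Poly_Mapping.lookup p k = Poly_Mapping.lookup
      (\<Sum>m\<in>Poly_Mapping.keys p. Poly_Mapping.single m (Poly_Mapping.lookup p m)) k"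
    by (simp add: lookup_sum in_keys_iff)
qed

lemma mon_poly_add: "mon_poly (m + n) = mon_poly m * mon_poly n"
  by (simp add: mon_poly_def mult_single)

lemma keys_mon_poly [simp]: "Poly_Mapping.keys (mon_poly m) = {m}"
  by (simp add: mon_poly_def)

text \<open>Translation of exponents is injective, so no terms cancel and the general inclusion
  \<open>keys_mult\<close> becomes an equality. This allows a colon by a variable to be tested term
  by term.\<close>

lemma keys_mon_poly_mult:
  fixes q :: "'a int_mpoly"
  shows "Poly_Mapping.keys (mon_poly k * q) = (+) k ` Poly_Mapping.keys q"
proof -
  have eq: "mon_poly k * q
      = (\<Sum>m\<in>Poly_Mapping.keys q. Poly_Mapping.single (k + m) (Poly_Mapping.lookup q m))"
    by (subst (1) poly_mapping_sum_single[of q])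
      (simp add: mon_poly_def sum_distrib_left mult_single)
  have "Poly_Mapping.lookup (mon_poly k * q) (k + m) = Poly_Mapping.lookup q m" for m
  proof -
    have "Poly_Mapping.lookup (mon_poly k * q) (k + m)
        = (\<Sum>n\<in>Poly_Mapping.keys q. if n = m then Poly_Mapping.lookup q n else 0)"
      unfolding eq lookup_sum by (rule sum.cong) (auto simp: lookup_single when_def)
    then show ?thesis by (simp add: in_keys_iff)
  qed
  then have "(+) k ` Poly_Mapping.keys q \<subseteq> Poly_Mapping.keys (mon_poly k * q)"
    by (auto simp: in_keys_iff)
  moreover have "Poly_Mapping.keys (mon_poly k * q) \<subseteq> (+) k ` Poly_Mapping.keys q"
    using keys_mult[of "mon_poly k" q] by auto
  ultimately show ?thesis by blast
qed

lemma mon_dvd_iff: "mon_dvd m n \<longleftrightarrow> (\<forall>x. Poly_Mapping.lookup m x \<le> Poly_Mapping.lookup n x)"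
proof
  assume "\<forall>x. Poly_Mapping.lookup m x \<le> Poly_Mapping.lookup n x"
  then have "n = m + (n - m)" by (intro poly_mapping_eqI) (simp add: lookup_add lookup_minus)
  then show "mon_dvd m n" unfolding mon_dvd_def by blast
qed (auto simp: mon_dvd_def lookup_add)

text \<open>The squarefree monomial with support \<open>\<sigma>\<close>. On an infinite set the sum
  takes its default value 0, hence the finiteness assumptions below.\<close>

definition mon_of :: "'a set \<Rightarrow> 'a mon" where
  "mon_of \<sigma> = (\<Sum>x\<in>\<sigma>. Poly_Mapping.single x 1)"

lemma lookup_mon_of: "finite \<sigma> \<Longrightarrow> Poly_Mapping.lookup (mon_of \<sigma>) x = (if x \<in> \<sigma> then 1 else 0)"
  by (simp add: mon_of_def lookup_sum lookup_single when_def)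

lemma keys_mon_of [simp]: "finite \<sigma> \<Longrightarrow> Poly_Mapping.keys (mon_of \<sigma>) = \<sigma>"
  by (auto simp: in_keys_iff lookup_mon_of split: if_splits)

lemma mon_of_empty [simp]: "mon_of {} = 0"
  by (simp add: mon_of_def)

lemma mon_of_singleton [simp]: "mon_of {x} = Poly_Mapping.single x 1"
  by (simp add: mon_of_def)

lemma mon_of_insert:
  "finite \<sigma> \<Longrightarrow> a \<notin> \<sigma> \<Longrightarrow> mon_of (insert a \<sigma>) = Poly_Mapping.single a 1 + mon_of \<sigma>"
  by (simp add: mon_of_def)

lemma mon_of_inject: "finite \<sigma> \<Longrightarrow> finite \<tau> \<Longrightarrow> mon_of \<sigma> = mon_of \<tau> \<longleftrightarrow> \<sigma> = \<tau>"
  by (metis keys_mon_of)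

lemma mon_of_image_iff:
  "simplicial \<Delta> \<Longrightarrow> finite \<sigma> \<Longrightarrow> mon_of \<sigma> \<in> mon_of ` \<Delta> \<longleftrightarrow> \<sigma> \<in> \<Delta>"
  by (auto simp: simplicial_def mon_of_inject)

lemma mon_dvd_mon_of_iff:
  "finite \<sigma> \<Longrightarrow> finite \<tau> \<Longrightarrow> mon_dvd (mon_of \<tau>) (mon_of \<sigma>) \<longleftrightarrow> \<tau> \<subseteq> \<sigma>"
  by (auto simp: mon_dvd_iff lookup_mon_of)

lemma mon_degree_mon_of: "finite \<sigma> \<Longrightarrow> mon_degree (mon_of \<sigma>) = card \<sigma>"
  by (simp add: mon_degree_def lookup_mon_of)

lemma mon_of_keys:
  assumes "\<And>x. Poly_Mapping.lookup m x \<le> 1"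
  shows "mon_of (Poly_Mapping.keys m) = m"
proof (rule poly_mapping_eqI)
  fix x
  show "Poly_Mapping.lookup (mon_of (Poly_Mapping.keys m)) x = Poly_Mapping.lookup m x"
    using assms[of x] by (auto simp: lookup_mon_of in_keys_iff)
qed

lemma mon_dvd_mon_ofD:
  assumes "finite \<sigma>" "mon_dvd m (mon_of \<sigma>)"
  shows "m = mon_of (Poly_Mapping.keys m)" "Poly_Mapping.keys m \<subseteq> \<sigma>"
proof -
  have le: "Poly_Mapping.lookup m x \<le> (if x \<in> \<sigma> then 1 else 0)" for x
    using assms(2) lookup_mon_of[OF assms(1), of x] by (metis mon_dvd_iff)
  have "Poly_Mapping.lookup m x \<le> 1" for x using le[of x] by (auto split: if_splits)
  then show "m = mon_of (Poly_Mapping.keys m)" by (simp add: mon_of_keys)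
  show "Poly_Mapping.keys m \<subseteq> \<sigma>"
    using le by (metis in_keys_iff le_zero_eq subsetI)
qed

lemma mon_dvd_closed:
  assumes "simplicial \<Delta>" "n \<in> mon_of ` \<Delta>" "mon_dvd m n"
  shows "m \<in> mon_of ` \<Delta>"
proof -
  obtain \<sigma> where \<sigma>: "\<sigma> \<in> \<Delta>" "n = mon_of \<sigma>" using assms(2) by blast
  then have "finite \<sigma>" using assms(1) by (auto simp: simplicial_def)
  with mon_dvd_mon_ofD[of \<sigma> m] \<sigma> assms show ?thesis by (metis imageI simplicialD)
qed

text \<open>A multiple of the variable \<open>a\<close> is squarefree only if the cofactor omits
  \<open>a\<close>. This matches the condition \<open>a \<notin> \<sigma>\<close> in
  \<open>link\<close> and is the monomial form of the passage from colon to link.\<close>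

lemma single_add_in_image_iff:
  assumes "simplicial \<Delta>"
  shows "Poly_Mapping.single a 1 + m \<in> mon_of ` \<Delta> \<longleftrightarrow> m \<in> mon_of ` link \<Delta> a"
proof
  assume "Poly_Mapping.single a 1 + m \<in> mon_of ` \<Delta>"
  then obtain \<sigma> where \<sigma>: "\<sigma> \<in> \<Delta>" "Poly_Mapping.single a 1 + m = mon_of \<sigma>" by auto
  then have fin: "finite \<sigma>" using assms by (auto simp: simplicial_def)
  have "mon_dvd m (mon_of \<sigma>)" by (simp flip: \<sigma>(2) add: mon_dvd_iff lookup_add)
  note m = mon_dvd_mon_ofD[OF fin this]
  have "1 + Poly_Mapping.lookup m a = Poly_Mapping.lookup (mon_of \<sigma>) a"
    by (simp flip: \<sigma>(2) add: lookup_add)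
  then have a: "a \<notin> Poly_Mapping.keys m"
    by (auto simp: lookup_mon_of[OF fin] in_keys_iff split: if_splits)
  have "mon_of \<sigma> = mon_of (insert a (Poly_Mapping.keys m))"
    using \<sigma>(2) m(1) mon_of_insert[OF finite_keys a] by metis
  then have "\<sigma> = insert a (Poly_Mapping.keys m)" by (simp add: mon_of_inject fin)
  then show "m \<in> mon_of ` link \<Delta> a" using m(1) a \<sigma>(1) by (auto simp: link_def)
next
  assume "m \<in> mon_of ` link \<Delta> a"
  then obtain \<sigma> where \<sigma>: "a \<notin> \<sigma>" "insert a \<sigma> \<in> \<Delta>" "m = mon_of \<sigma>" by (auto simp: link_def)
  then have "finite \<sigma>" using assms by (auto simp: simplicial_def)
  then show "Poly_Mapping.single a 1 + m \<in> mon_of ` \<Delta>"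
    using \<sigma> mon_of_insert by (metis imageI)
qed

text \<open>For a simplicial family on \<open>X\<close> this is the Stanley-Reisner ideal enlarged
  by the squares of the variables. Since it is a monomial ideal, membership can be expressed through
  the terms of a polynomial, without generators.\<close>

definition sr_ideal :: "'a set \<Rightarrow> 'a set set \<Rightarrow> 'a int_mpoly set" where
  "sr_ideal X \<Delta> = {p \<in> carrier (int_poly_ring X). \<forall>m\<in>Poly_Mapping.keys p. m \<notin> mon_of ` \<Delta>}"

lemma ring_int_poly_ring: "ring (int_poly_ring X)"
  using cring_int_poly_ring by (rule cring.axioms(1))

lemma carrier_int_poly_ring_iff:
  "p \<in> carrier (int_poly_ring X) \<longleftrightarrow> (\<forall>m\<in>Poly_Mapping.keys p. Poly_Mapping.keys m \<subseteq> X)"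
  by (simp add: int_poly_ring_def)

lemma mult_int_poly_ring [simp]: "p \<otimes>\<^bsub>int_poly_ring X\<^esub> q = p * q"
  by (simp add: int_poly_ring_def)

lemma add_int_poly_ring [simp]: "p \<oplus>\<^bsub>int_poly_ring X\<^esub> q = p + q"
  by (simp add: int_poly_ring_def)

lemma zero_int_poly_ring [simp]: "\<zero>\<^bsub>int_poly_ring X\<^esub> = 0"
  by (simp add: int_poly_ring_def)

lemma mon_poly_carrier [simp]:
  "mon_poly m \<in> carrier (int_poly_ring X) \<longleftrightarrow> Poly_Mapping.keys m \<subseteq> X"
  by (simp add: carrier_int_poly_ring_iff)

lemma Var_carrier [simp]: "Var x \<in> carrier (int_poly_ring X) \<longleftrightarrow> x \<in> X"
  by (simp add: Var_def)

lemma mon_poly_in_sr_ideal: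
  "mon_poly m \<in> sr_ideal X \<Delta> \<longleftrightarrow> Poly_Mapping.keys m \<subseteq> X \<and> m \<notin> mon_of ` \<Delta>"
  by (simp add: sr_ideal_def)

lemma Var_in_sr_ideal:
  "simplicial \<Delta> \<Longrightarrow> x \<in> X \<Longrightarrow> Var x \<in> sr_ideal X \<Delta> \<longleftrightarrow> {x} \<notin> \<Delta>"
  by (simp add: Var_def mon_poly_in_sr_ideal mon_of_image_iff[of \<Delta> "{x}", simplified])

text \<open>Each term of the product is a multiple of a term of \<open>p\<close>, and divisors of
  standard monomials are standard.\<close>

lemma sr_ideal_closed_mult:
  assumes "simplicial \<Delta>" "p \<in> sr_ideal X \<Delta>" "q \<in> carrier (int_poly_ring X)"
  shows "p * q \<in> sr_ideal X \<Delta>"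
proof -
  have "m \<notin> mon_of ` \<Delta>" if keys: "m \<in> Poly_Mapping.keys (p * q)" for m
  proof
    assume m: "m \<in> mon_of ` \<Delta>"
    obtain k l where kl: "m = k + l" "k \<in> Poly_Mapping.keys p"
      using subsetD[OF keys_mult keys] by auto
    then have "k \<in> mon_of ` \<Delta>" using mon_dvd_closed[OF assms(1) m] unfolding mon_dvd_def by blast
    then show False using kl(2) assms(2) by (auto simp: sr_ideal_def)
  qed
  moreover have "p * q \<in> carrier (int_poly_ring X)"
    using int_poly_ring_mult_closed assms(2,3) by (auto simp: sr_ideal_def)
  ultimately show ?thesis by (simp add: sr_ideal_def)
qed

lemma ideal_sr_ideal:
  assumes "simplicial \<Delta>"
  shows "ideal (sr_ideal X \<Delta>) (int_poly_ring X)"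
proof (rule idealI[OF ring_int_poly_ring])
  interpret R: ring "int_poly_ring X" by (rule ring_int_poly_ring)
  have minus: "\<ominus>\<^bsub>int_poly_ring X\<^esub> p = - p" if "p \<in> carrier (int_poly_ring X)" for p
    using that by (intro R.minus_equality) (simp_all add: carrier_int_poly_ring_iff)
  show "subgroup (sr_ideal X \<Delta>) (add_monoid (int_poly_ring X))"
  proof (rule R.add.subgroupI)
    show "sr_ideal X \<Delta> \<subseteq> carrier (int_poly_ring X)" by (auto simp: sr_ideal_def)
    have "0 \<in> sr_ideal X \<Delta>" by (simp add: sr_ideal_def carrier_int_poly_ring_iff)
    then show "sr_ideal X \<Delta> \<noteq> {}" by blast
    show "\<ominus>\<^bsub>int_poly_ring X\<^esub> p \<in> sr_ideal X \<Delta>" if "p \<in> sr_ideal X \<Delta>" for p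
      using that minus[of p] by (simp add: sr_ideal_def carrier_int_poly_ring_iff)
    show "p \<oplus>\<^bsub>int_poly_ring X\<^esub> q \<in> sr_ideal X \<Delta>" if "p \<in> sr_ideal X \<Delta>" "q \<in> sr_ideal X \<Delta>" for p q
      using that subsetD[OF keys_add[of p q]]
      by (auto simp: sr_ideal_def int_poly_ring_add_closed)
  qed
next
  fix p q assume "p \<in> sr_ideal X \<Delta>" "q \<in> carrier (int_poly_ring X)"
  from sr_ideal_closed_mult[OF assms this]
  show "q \<otimes>\<^bsub>int_poly_ring X\<^esub> p \<in> sr_ideal X \<Delta>" "p \<otimes>\<^bsub>int_poly_ring X\<^esub> q \<in> sr_ideal X \<Delta>"
    by (simp_all add: mult.commute)
qed

text \<open>The criterion by which generated ideals are translated into families of faces. A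
  polynomial is the sum of its terms, so it suffices that each nonstandard monomial is a multiple of
  a monomial in \<open>S\<close>.\<close>

lemma genideal_eq_sr_ideal:
  assumes "simplicial \<Delta>" "S \<subseteq> sr_ideal X \<Delta>"
    and gen: "\<And>m. Poly_Mapping.keys m \<subseteq> X \<Longrightarrow> m \<notin> mon_of ` \<Delta> \<Longrightarrow> \<exists>n. mon_dvd n m \<and> mon_poly n \<in> S"
  shows "Idl\<^bsub>int_poly_ring X\<^esub> S = sr_ideal X \<Delta>"
proof
  interpret R: ring "int_poly_ring X" by (rule ring_int_poly_ring)
  show "Idl\<^bsub>int_poly_ring X\<^esub> S \<subseteq> sr_ideal X \<Delta>"
    using R.genideal_minimal[OF ideal_sr_ideal[OF assms(1)] assms(2)] .
  have S: "S \<subseteq> carrier (int_poly_ring X)" using assms(2) by (auto simp: sr_ideal_def)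
  interpret I: ideal "Idl\<^bsub>int_poly_ring X\<^esub> S" "int_poly_ring X" by (rule R.genideal_ideal[OF S])
  have mon: "Poly_Mapping.single m c \<in> Idl\<^bsub>int_poly_ring X\<^esub> S"
    if m: "Poly_Mapping.keys m \<subseteq> X" "m \<notin> mon_of ` \<Delta>" for m c
  proof -
    obtain n where n: "mon_dvd n m" "mon_poly n \<in> S" using gen[OF m] by blast
    then obtain k where k: "m = n + k" by (auto simp: mon_dvd_def)
    then have "Poly_Mapping.keys k \<subseteq> X"
      using m(1) by (auto simp: in_keys_iff lookup_add)
    then have "mon_poly m \<in> Idl\<^bsub>int_poly_ring X\<^esub> S"
      using I.I_r_closed[of "mon_poly n" "mon_poly k"] subsetD[OF R.genideal_self[OF S] n(2)]
      by (simp add: k mon_poly_add)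
    \<comment> \<open>The coefficient is supplied by multiplication with a constant
      polynomial.\<close>
    moreover have "Poly_Mapping.single 0 c \<in> carrier (int_poly_ring X)"
      by (auto simp: carrier_int_poly_ring_iff split: if_splits)
    ultimately show ?thesis
      using I.I_r_closed[of "mon_poly m" "Poly_Mapping.single 0 c"]
      by (simp add: mon_poly_def mult_single)
  qed
  show "sr_ideal X \<Delta> \<subseteq> Idl\<^bsub>int_poly_ring X\<^esub> S"
  proof
    fix p assume p: "p \<in> sr_ideal X \<Delta>"
    have "(\<Sum>m\<in>A. Poly_Mapping.single m (Poly_Mapping.lookup p m)) \<in> Idl\<^bsub>int_poly_ring X\<^esub> S"
      if "finite A" "A \<subseteq> Poly_Mapping.keys p" for A
      using that
    proof (induction A rule: finite_induct)
      case empty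
      then show ?case using I.zero_closed by simp
    next
      case (insert m A)
      then have "Poly_Mapping.single m (Poly_Mapping.lookup p m) \<in> Idl\<^bsub>int_poly_ring X\<^esub> S"
        using p by (intro mon) (auto simp: sr_ideal_def carrier_int_poly_ring_iff)
      then show ?case using insert I.a_closed by fastforce
    qed
    from this[of "Poly_Mapping.keys p"] show "p \<in> Idl\<^bsub>int_poly_ring X\<^esub> S"
      using poly_mapping_sum_single[of p] by simp
  qed
qed

lemma sr_ideal_mono: "\<Delta> \<subseteq> \<Gamma> \<Longrightarrow> sr_ideal X \<Gamma> \<subseteq> sr_ideal X \<Delta>"
  by (auto simp: sr_ideal_def)

text \<open>A face is recovered from the ideal by testing its squarefree monomial. Faces must lie in
  \<open>X\<close>, because the ideal sees only monomials in these variables.\<close>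

lemma sr_ideal_inject:
  assumes "simplicial \<Delta>" "simplicial \<Gamma>" "\<Delta> \<subseteq> Pow X" "\<Gamma> \<subseteq> Pow X"
  shows "sr_ideal X \<Delta> = sr_ideal X \<Gamma> \<longleftrightarrow> \<Delta> = \<Gamma>"
proof
  have *: "\<Delta> \<subseteq> \<Gamma>" if "sr_ideal X \<Gamma> \<subseteq> sr_ideal X \<Delta>" "simplicial \<Delta>" "simplicial \<Gamma>" "\<Delta> \<subseteq> Pow X"
    for \<Delta> \<Gamma> :: "'a set set"
  proof
    fix \<sigma> assume \<sigma>: "\<sigma> \<in> \<Delta>"
    then have fin: "finite \<sigma>" "\<sigma> \<subseteq> X" using that by (auto simp: simplicial_def)
    have "mon_poly (mon_of \<sigma>) \<notin> sr_ideal X \<Gamma>"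
      using subsetD[OF that(1), of "mon_poly (mon_of \<sigma>)"] \<sigma> by (auto simp: mon_poly_in_sr_ideal)
    then show "\<sigma> \<in> \<Gamma>" using fin that(3) by (simp add: mon_poly_in_sr_ideal mon_of_image_iff)
  qed
  assume "sr_ideal X \<Delta> = sr_ideal X \<Gamma>"
  then show "\<Delta> = \<Gamma>" using *[of \<Delta> \<Gamma>] *[of \<Gamma> \<Delta>] assms by blast
qed simp

section \<open>Colon and adjunction as link and deletion\<close>

lemma colon_sr_ideal:
  assumes "simplicial \<Delta>" "a \<in> X"
  shows "colon X (sr_ideal X \<Delta>) (Var a) = sr_ideal X (link \<Delta> a)"
proof -
  have "Var a * q \<in> sr_ideal X \<Delta> \<longleftrightarrow> (\<forall>m\<in>Poly_Mapping.keys q. m \<notin> mon_of ` link \<Delta> a)"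
    if "q \<in> carrier (int_poly_ring X)" for q
  proof -
    have "Var a * q \<in> carrier (int_poly_ring X)"
      using int_poly_ring_mult_closed[of "Var a"] that assms(2) by simp
    then show ?thesis
      by (simp add: sr_ideal_def) (simp add: Var_def keys_mon_poly_mult single_add_in_image_iff[OF assms(1), simplified])
  qed
  then show ?thesis by (auto simp: colon_def sr_ideal_def[of _ "link \<Delta> a"])
qed

lemma adjoin_sr_ideal:
  assumes "simplicial \<Delta>" "a \<in> X"
  shows "adjoin X (sr_ideal X \<Delta>) (Var a) = sr_ideal X (deletion \<Delta> a)"
  unfolding adjoin_def
proof (rule genideal_eq_sr_ideal[OF simplicial_deletion[OF assms(1)]])
  show "insert (Var a) (sr_ideal X \<Delta>) \<subseteq> sr_ideal X (deletion \<Delta> a)"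
    using assms Var_in_sr_ideal[OF simplicial_deletion[OF assms(1)], of a X a]
      sr_ideal_mono[of "deletion \<Delta> a" \<Delta>] by (auto simp: deletion_def)
  fix m assume m: "Poly_Mapping.keys m \<subseteq> X" "m \<notin> mon_of ` deletion \<Delta> a"
  show "\<exists>n. mon_dvd n m \<and> mon_poly n \<in> insert (Var a) (sr_ideal X \<Delta>)"
  \<comment> \<open>A standard monomial lost in the deletion has \<open>a\<close> in its support and
    is a multiple of the new generator; every other nonstandard monomial was in the ideal
    before.\<close>
  proof (cases "m \<in> mon_of ` \<Delta>")
    case True
    then obtain \<sigma> where \<sigma>: "m = mon_of \<sigma>" "\<sigma> \<in> \<Delta>" "a \<in> \<sigma>" using m(2) by (auto simp: deletion_def)
    then have "mon_dvd (mon_of {a}) m"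
      using assms(1) mon_dvd_mon_of_iff[of \<sigma> "{a}"] by (auto simp: simplicial_def)
    then show ?thesis by (auto simp: Var_def)
  next
    case False
    then have "mon_poly m \<in> sr_ideal X \<Delta>" using m(1) by (simp add: mon_poly_in_sr_ideal)
    moreover have "mon_dvd m m" by (simp add: mon_dvd_iff)
    ultimately show ?thesis by blast
  qed
qed

lemma is_cone_sr_ideal:
  assumes "simplicial \<Delta>" "a \<in> X" "\<Delta> \<subseteq> Pow X"
  shows "is_cone X (sr_ideal X \<Delta>) a \<longleftrightarrow> cone_apex \<Delta> a"
proof -
  have "link \<Delta> a \<subseteq> Pow X" "deletion \<Delta> a \<subseteq> Pow X"
    using assms(3) by (auto simp: link_def deletion_def)
  then show ?thesis
    using assms sr_ideal_inject[of "link \<Delta> a" "deletion \<Delta> a" X]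
    by (simp add: is_cone_def colon_sr_ideal adjoin_sr_ideal cone_apex_iff
        simplicial_link simplicial_deletion)
qed

lemma dominates_sr_ideal:
  assumes "simplicial \<Delta>" "a \<in> X" "b \<in> X" "\<Delta> \<subseteq> Pow X"
  shows "dominates X (sr_ideal X \<Delta>) a b \<longleftrightarrow> \<not> cone_apex \<Delta> b \<and> cone_apex (deletion \<Delta> a) b"
proof -
  have "deletion \<Delta> a \<subseteq> Pow X" using assms(4) by (auto simp: deletion_def)
  then show ?thesis
    using assms by (simp add: dominates_def is_cone_sr_ideal adjoin_sr_ideal simplicial_deletion)
qed

lemma complex_of_sr_ideal:
  assumes "simplicial \<Delta>" "\<Delta> \<subseteq> Pow X"
  shows "complex_of X (sr_ideal X \<Delta>) = mon_of ` \<Delta>"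
  using assms by (fastforce simp: complex_of_def mon_poly_in_sr_ideal simplicial_def)

section \<open>Ideals presented by generators\<close>

lemma prod_Var: "finite \<sigma> \<Longrightarrow> (\<Prod>x\<in>\<sigma>. Var x) = mon_poly (mon_of \<sigma>)"
  by (induction \<sigma> rule: finite_induct)
    (simp_all add: mon_of_insert mon_poly_add Var_def, simp add: mon_poly_def)

text \<open>The common translation for star ideals and for cross-polytopes. A nonstandard monomial
  either has an exponent of at least 2, hence is a multiple of a square, or is squarefree with
  support containing a member of \<open>G\<close>.\<close>

lemma genideal_squares_eq_sr_ideal:
  assumes "finite X" "G \<subseteq> Pow X"
  shows "Idl\<^bsub>int_poly_ring X\<^esub> ((\<lambda>x. (Var x)\<^sup>2) ` X \<union> (\<lambda>g. \<Prod>x\<in>g. Var x) ` G)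
    = sr_ideal X {\<sigma>. \<sigma> \<subseteq> X \<and> (\<forall>g\<in>G. \<not> g \<subseteq> \<sigma>)}" (is "Idl\<^bsub>_\<^esub> ?S = sr_ideal X ?\<Delta>")
proof (rule genideal_eq_sr_ideal)
  show simp: "simplicial ?\<Delta>"
    unfolding simplicial_def using finite_subset[OF _ assms(1)] by (simp, meson order_trans)
  have square: "(Var x)\<^sup>2 = mon_poly (Poly_Mapping.single x 2)" for x :: 'a
    by (simp add: power2_eq_square Var_def numeral_2_eq_2 flip: mon_poly_add single_add)
  have prod: "(\<Prod>x\<in>g. Var x) = mon_poly (mon_of g)" if "g \<in> G" for g
    using that assms finite_subset by (intro prod_Var) blast
  show "?S \<subseteq> sr_ideal X ?\<Delta>"
  proof
    fix p assume "p \<in> ?S"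
    then consider x where "x \<in> X" "p = (Var x)\<^sup>2" | g where "g \<in> G" "p = (\<Prod>x\<in>g. Var x)" by blast
    then show "p \<in> sr_ideal X ?\<Delta>"
    proof cases
      case 1
      have "Poly_Mapping.single x 2 \<noteq> mon_of \<sigma>" if "\<sigma> \<in> ?\<Delta>" for \<sigma>
      proof
        assume *: "Poly_Mapping.single x 2 = mon_of \<sigma>"
        have "finite \<sigma>" using that finite_subset[OF _ assms(1)] by blast
        then have "Poly_Mapping.lookup (Poly_Mapping.single x (2::nat)) x \<le> 1"
          unfolding * by (simp add: lookup_mon_of)
        then show False by simp
      qed
      then show ?thesis using 1 by (auto simp: square mon_poly_in_sr_ideal)
    next
      case 2
      then have "g \<subseteq> X" "finite g" using assms finite_subset by blast+
      then show ?thesis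
        using 2 by (auto simp add: prod mon_poly_in_sr_ideal mon_of_image_iff[OF simp])
    qed
  qed
  fix m assume m: "Poly_Mapping.keys m \<subseteq> X" "m \<notin> mon_of ` ?\<Delta>"
  show "\<exists>n. mon_dvd n m \<and> mon_poly n \<in> ?S"
  proof (cases "\<exists>x. Poly_Mapping.lookup m x \<ge> 2")
    case True
    then obtain x where x: "Poly_Mapping.lookup m x \<ge> 2" by blast
    then have "x \<in> X" using m(1) by (auto simp: in_keys_iff)
    moreover have "mon_dvd (Poly_Mapping.single x 2) m"
      using x by (auto simp: mon_dvd_iff lookup_single when_def)
    ultimately show ?thesis by (metis UnI1 imageI square)
  next
    case False
    then have "Poly_Mapping.lookup m x < 2" for x by (meson not_le)
    then have "Poly_Mapping.lookup m x \<le> 1" for x by (simp add: less_2_cases_iff le_Suc_eq)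
    then have eq: "mon_of (Poly_Mapping.keys m) = m" by (rule mon_of_keys)
    have "Poly_Mapping.keys m \<notin> ?\<Delta>"
    proof
      assume "Poly_Mapping.keys m \<in> ?\<Delta>"
      from imageI[OF this, of mon_of] show False using m(2) eq by simp
    qed
    then obtain g where g: "g \<in> G" "g \<subseteq> Poly_Mapping.keys m" using m(1) by blast
    then have "mon_dvd (mon_of g) (mon_of (Poly_Mapping.keys m))"
      using mon_dvd_mon_of_iff[of "Poly_Mapping.keys m" g] finite_subset[OF g(2)] by simp
    then show ?thesis using g(1) prod[OF g(1)] unfolding eq by (metis UnI2 imageI)
  qed
qed

lemma genideal_Var_eq_sr_ideal: "Idl\<^bsub>int_poly_ring X\<^esub> (Var ` X) = sr_ideal X {{}}"
proof (rule genideal_eq_sr_ideal)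
  show simp: "simplicial {{}}" by (simp add: simplicial_def)
  show "Var ` X \<subseteq> sr_ideal X {{}}" by (auto simp: Var_in_sr_ideal[OF simp])
  fix m assume m: "Poly_Mapping.keys m \<subseteq> X" "m \<notin> mon_of ` {{} :: 'a set}"
  then obtain x where x: "x \<in> Poly_Mapping.keys m" by fastforce
  then have "mon_dvd (Poly_Mapping.single x 1) m"
    by (auto simp: mon_dvd_iff lookup_single when_def in_keys_iff)
  then show "\<exists>n. mon_dvd n m \<and> mon_poly n \<in> Var ` X"
    using x m(1) by (auto simp: Var_def)
qed

section \<open>Resolutions\<close>

lemma colon_seq_Nil: "I \<subseteq> carrier (int_poly_ring X) \<Longrightarrow> colon_seq X I [] = I"
  by (auto simp: colon_seq_def colon_def)

lemma colon_seq_snoc: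
  "a \<in> X \<Longrightarrow> colon_seq X I (as @ [a]) = colon X (colon_seq X I as) (Var a)"
  using int_poly_ring_mult_closed[of "Var a" X] by (auto simp: colon_seq_def colon_def mult.assoc)

lemma resolution_snoc:
  "resolution X I (as @ [a]) \<longleftrightarrow> resolution X I as \<and> a \<in> X \<and> Var a \<notin> colon_seq X I as \<and>
    (is_cone X (colon_seq X I as) a \<or> (\<exists>b\<in>X. dominates X (colon_seq X I as) a b))"
  by (auto simp: resolution_def nth_append less_Suc_eq)

text \<open>The invariant is that the length plus the suspension depth of the current link equals
  \<open>d\<close>. Since iterated suspensions are not cones, each new entry dominates some vertex,
  and \<open>iterated_suspension_link\<close> lowers the depth by exactly one, whichever entry is
  chosen.\<close>

lemma resolution_core:
  assumes "iterated_suspension \<Delta> d" "simplicial \<Delta>" "\<Delta> \<subseteq> Pow X" "resolution X (sr_ideal X \<Delta>) as"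
  shows "\<exists>\<Gamma> e. colon_seq X (sr_ideal X \<Delta>) as = sr_ideal X \<Gamma> \<and> simplicial \<Gamma> \<and> \<Gamma> \<subseteq> Pow X \<and>
    iterated_suspension \<Gamma> e \<and> d = length as + e"
  using assms(4)
proof (induction as rule: rev_induct)
  case Nil
  have "sr_ideal X \<Delta> \<subseteq> carrier (int_poly_ring X)" by (auto simp: sr_ideal_def)
  then show ?case using assms by (auto simp: colon_seq_Nil)
next
  case (snoc a as)
  then obtain \<Gamma> e where \<Gamma>: "colon_seq X (sr_ideal X \<Delta>) as = sr_ideal X \<Gamma>" "simplicial \<Gamma>" "\<Gamma> \<subseteq> Pow X"
    "iterated_suspension \<Gamma> e" "d = length as + e" by (auto simp: resolution_snoc)
  note res = snoc.prems[unfolded resolution_snoc \<Gamma>(1)]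
  have a: "a \<in> X" "{a} \<in> \<Gamma>" using res Var_in_sr_ideal[OF \<Gamma>(2)] by blast+
  obtain b where b: "\<not> cone_apex \<Gamma> b" "cone_apex (deletion \<Gamma> a) b"
    using res is_cone_sr_ideal[OF \<Gamma>(2) a(1) \<Gamma>(3)] dominates_sr_ideal[OF \<Gamma>(2) a(1) _ \<Gamma>(3)]
      iterated_suspension_not_cone[OF \<Gamma>(4,2)] by blast
  obtain e' where "e = Suc e'" "iterated_suspension (link \<Gamma> a) e'"
    using iterated_suspension_link[OF \<Gamma>(4,2) a(2) b(2,1)] by blast
  moreover have "link \<Gamma> a \<subseteq> Pow X" using \<Gamma>(3) by (auto simp: link_def)
  moreover have "colon_seq X (sr_ideal X \<Delta>) (as @ [a]) = sr_ideal X (link \<Gamma> a)"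
    by (simp add: colon_seq_snoc a(1) \<Gamma>(1,2) colon_sr_ideal)
  moreover have "simplicial (link \<Gamma> a)" by (rule simplicial_link[OF \<Gamma>(2)])
  ultimately show ?case
    using \<Gamma>(5) by (intro exI[of _ "link \<Gamma> a"] exI[of _ e']) simp
qed

text \<open>A resolution shorter than \<open>d\<close> leaves an iterated suspension of positive
  depth, whose pole \<open>a\<close> dominates the other pole \<open>b\<close> and serves as the
  next entry.\<close>

lemma iterated_suspension_resolution_extend:
  assumes "iterated_suspension \<Delta> d" "simplicial \<Delta>" "\<Delta> \<subseteq> Pow X" "resolution X (sr_ideal X \<Delta>) as"
    "length as < d"
  shows "\<exists>a. resolution X (sr_ideal X \<Delta>) (as @ [a])"
proof -
  obtain \<Gamma> e where \<Gamma>: "colon_seq X (sr_ideal X \<Delta>) as = sr_ideal X \<Gamma>" "simplicial \<Gamma>" "\<Gamma> \<subseteq> Pow X"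
    "iterated_suspension \<Gamma> e" "d = length as + e" using resolution_core[OF assms(1-4)] by blast
  from \<Gamma>(4) show ?thesis
  proof cases
    case base
    then show ?thesis using \<Gamma>(5) assms(5) by simp
  next
    case (step a b e')
    have empty: "{} \<in> \<Gamma>" using simplicialD[OF \<Gamma>(2) step(2)] by simp
    then have b: "{b} \<in> \<Gamma>" using cone_deletionD[OF step(4)] by simp
    have X: "a \<in> X" "b \<in> X" using \<Gamma>(3) step(2) b by auto
    have "\<not> cone_apex \<Gamma> b" by (rule iterated_suspension_not_cone[OF \<Gamma>(4,2)])
    then have "dominates X (sr_ideal X \<Gamma>) a b"
      using dominates_sr_ideal[OF \<Gamma>(2) X \<Gamma>(3)] step(4) by simp
    moreover have "Var a \<notin> sr_ideal X \<Gamma>" using Var_in_sr_ideal[OF \<Gamma>(2) X(1)] step(2) by simp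
    ultimately show ?thesis
      using assms(4) X unfolding resolution_snoc \<Gamma>(1) by blast
  qed
qed

text \<open>The invariant of \<open>resolution_core\<close> bounds every length by \<open>d\<close>,
  and every shorter resolution extends. Hence all maximal resolutions have the same depth.\<close>

lemma maximal_resolution_iff:
  assumes "iterated_suspension \<Delta> d" "simplicial \<Delta>" "\<Delta> \<subseteq> Pow X"
  shows "maximal_resolution X (sr_ideal X \<Delta>) as \<longleftrightarrow> resolution X (sr_ideal X \<Delta>) as \<and> length as = d"
proof (cases "resolution X (sr_ideal X \<Delta>) as")
  case True
  have "length as \<le> d" using resolution_core[OF assms True] by auto
  moreover have "\<not> resolution X (sr_ideal X \<Delta>) (as @ [a])" if "length as = d" for a
    using resolution_core[OF assms, of "as @ [a]"] that by auto
  ultimately show ?thesis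
    using True iterated_suspension_resolution_extend[OF assms True]
    by (auto simp: maximal_resolution_def le_less)
qed (simp add: maximal_resolution_def)

lemma iterated_suspension_resolution_exists:
  assumes "iterated_suspension \<Delta> d" "simplicial \<Delta>" "\<Delta> \<subseteq> Pow X" "n \<le> d"
  shows "\<exists>as. resolution X (sr_ideal X \<Delta>) as \<and> length as = n"
  using assms(4)
proof (induction n)
  case 0
  then show ?case by (auto simp: resolution_def)
next
  case (Suc n)
  then obtain as where "resolution X (sr_ideal X \<Delta>) as" "length as = n" by auto
  with iterated_suspension_resolution_extend[OF assms(1-3), of as] Suc.prems show ?case
    by (metis Suc_le_lessD length_append_singleton)
qed

text \<open>At length \<open>d\<close> the remaining suspension depth is 0, so the core belongs to
  \<open>{{}}\<close>. The minimum defining the depth ranges over the single value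
  \<open>d\<close>.\<close>

lemma iterated_suspension_simple:
  assumes "iterated_suspension \<Delta> d" "simplicial \<Delta>" "\<Delta> \<subseteq> Pow X"
  shows "simple_ideal X (sr_ideal X \<Delta>)" "resolution_depth X (sr_ideal X \<Delta>) = d"
proof -
  obtain as where as: "resolution X (sr_ideal X \<Delta>) as" "length as = d"
    using iterated_suspension_resolution_exists[OF assms order_refl] by blast
  then have max: "maximal_resolution X (sr_ideal X \<Delta>) as"
    using maximal_resolution_iff[OF assms] by blast
  have "colon_seq X (sr_ideal X \<Delta>) as = sr_ideal X {{}}"
    using resolution_core[OF assms as(1)] as(2) by (auto simp: iterated_suspension_0)
  then show "simple_ideal X (sr_ideal X \<Delta>)"
    using max unfolding simple_ideal_def genideal_Var_eq_sr_ideal by blast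
  show "resolution_depth X (sr_ideal X \<Delta>) = d"
    unfolding resolution_depth_def maximal_resolution_iff[OF assms]
    using as by (intro Least_equality) auto
qed

section \<open>Collapses onto cross-polytopes\<close>

text \<open>Writing the larger face as \<open>insert x \<tau>\<close> builds in the degree
  condition. Its maximality follows from the condition on the faces above
  \<open>\<tau>\<close>.\<close>

definition face_collapse :: "'a set set \<Rightarrow> 'a set set \<Rightarrow> bool" where
  "face_collapse \<Delta> \<Delta>' \<longleftrightarrow> (\<exists>\<tau> x. x \<notin> \<tau> \<and> \<tau> \<in> \<Delta> \<and> insert x \<tau> \<in> \<Delta> \<and>
    (\<forall>\<rho>\<in>\<Delta>. \<tau> \<subseteq> \<rho> \<longrightarrow> \<rho> = \<tau> \<or> \<rho> = insert x \<tau>) \<and> \<Delta>' = \<Delta> - {\<tau>, insert x \<tau>})"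

lemma face_collapse_subset: "face_collapse\<^sup>*\<^sup>* \<Delta> \<Delta>' \<Longrightarrow> \<Delta>' \<subseteq> \<Delta>"
  by (induction rule: rtranclp_induct) (auto simp: face_collapse_def)

lemma face_collapse_mon_of:
  assumes "face_collapse \<Delta> \<Delta>'" "\<And>\<sigma>. \<sigma> \<in> \<Delta> \<Longrightarrow> finite \<sigma>"
  shows "elementary_collapse (mon_of ` \<Delta>) (mon_of ` \<Delta>')"
proof -
  obtain \<tau> x where x: "x \<notin> \<tau>" "\<tau> \<in> \<Delta>" "insert x \<tau> \<in> \<Delta>"
    "\<And>\<rho>. \<rho> \<in> \<Delta> \<Longrightarrow> \<tau> \<subseteq> \<rho> \<Longrightarrow> \<rho> = \<tau> \<or> \<rho> = insert x \<tau>" "\<Delta>' = \<Delta> - {\<tau>, insert x \<tau>}"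
    using assms(1) unfolding face_collapse_def by blast
  have fin: "finite \<tau>" using x assms(2) by blast
  have inj: "inj_on mon_of \<Delta>" using assms(2) by (auto simp: inj_on_def mon_of_inject)
  show ?thesis
    unfolding elementary_collapse_def
  proof (rule bexI[of _ "mon_of (insert x \<tau>)"], rule bexI[of _ "mon_of \<tau>"], intro conjI ballI impI)
    fix \<rho> assume \<rho>: "\<rho> \<in> mon_of ` \<Delta>" "mon_dvd (mon_of (insert x \<tau>)) \<rho>"
    then obtain \<sigma> where \<sigma>: "\<rho> = mon_of \<sigma>" "\<sigma> \<in> \<Delta>" by blast
    then have "insert x \<tau> \<subseteq> \<sigma>" using \<rho>(2) assms(2) fin by (simp add: mon_dvd_mon_of_iff)
    then show "\<rho> = mon_of (insert x \<tau>)" using x(4)[OF \<sigma>(2)] x(1) \<sigma>(1) by auto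
  next
    fix \<rho> assume \<rho>: "\<rho> \<in> mon_of ` \<Delta>" "mon_dvd (mon_of \<tau>) \<rho> \<and> \<rho> \<noteq> mon_of \<tau>"
    then obtain \<sigma> where \<sigma>: "\<rho> = mon_of \<sigma>" "\<sigma> \<in> \<Delta>" by blast
    then have "\<tau> \<subseteq> \<sigma>" using \<rho>(2) assms(2) fin by (simp add: mon_dvd_mon_of_iff)
    then show "\<rho> = mon_of (insert x \<tau>)" using x(4)[OF \<sigma>(2)] \<rho>(2) \<sigma>(1) by auto
  next
    show "mon_of ` \<Delta>' = mon_of ` \<Delta> - {mon_of (insert x \<tau>), mon_of \<tau>}"
      using inj_on_image_set_diff[OF inj, of \<Delta> "{\<tau>, insert x \<tau>}"] x by (simp add: insert_commute)
  qed (use x fin in \<open>auto simp: mon_dvd_mon_of_iff mon_degree_mon_of\<close>)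
qed

lemma face_collapses_mon_of:
  assumes "face_collapse\<^sup>*\<^sup>* \<Delta> \<Delta>'" "\<And>\<sigma>. \<sigma> \<in> \<Delta> \<Longrightarrow> finite \<sigma>"
  shows "collapses_onto (mon_of ` \<Delta>) (mon_of ` \<Delta>')"
  using assms(1)
proof (induction rule: rtranclp_induct)
  case base
  then show ?case by (simp add: collapses_onto_def)
next
  case (step \<Gamma> \<Gamma>')
  have "elementary_collapse (mon_of ` \<Gamma>) (mon_of ` \<Gamma>')"
    using face_collapse_mon_of[OF step.hyps(2)] face_collapse_subset[OF step.hyps(1)] assms(2) by blast
  then show ?case using step.IH by (simp add: collapses_onto_def)
qed

text \<open>A collapse of the base lifts to the cone by adding the apex to both removed faces. Faces
  in \<open>D\<close> avoid \<open>a\<close>, so none of them contains the lifted free face.\<close>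

lemma face_collapse_cone:
  assumes "face_collapse L L'" "\<And>\<sigma>. \<sigma> \<in> L \<Longrightarrow> a \<notin> \<sigma>" "\<And>\<sigma>. \<sigma> \<in> D \<Longrightarrow> a \<notin> \<sigma>"
  shows "face_collapse (D \<union> insert a ` L) (D \<union> insert a ` L')"
proof -
  obtain \<tau> x where x: "x \<notin> \<tau>" "\<tau> \<in> L" "insert x \<tau> \<in> L"
    "\<And>\<rho>. \<rho> \<in> L \<Longrightarrow> \<tau> \<subseteq> \<rho> \<Longrightarrow> \<rho> = \<tau> \<or> \<rho> = insert x \<tau>" "L' = L - {\<tau>, insert x \<tau>}"
    using assms(1) unfolding face_collapse_def by blast
  have inj: "inj_on (insert a) L"
    using assms(2) by (meson inj_onI insert_ident)
  show ?thesis
    unfolding face_collapse_def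
  proof (intro exI conjI ballI impI)
    show "x \<notin> insert a \<tau>" using x assms(2)[OF x(3)] by auto
    show "insert a \<tau> \<in> D \<union> insert a ` L" "insert x (insert a \<tau>) \<in> D \<union> insert a ` L"
      using x by (auto simp: insert_commute[of x a])
  next
    fix \<rho> assume \<rho>: "\<rho> \<in> D \<union> insert a ` L" "insert a \<tau> \<subseteq> \<rho>"
    then obtain \<sigma> where \<sigma>: "\<sigma> \<in> L" "\<rho> = insert a \<sigma>" using assms(3) by blast
    then have "\<tau> \<subseteq> \<sigma>" using \<rho>(2) assms(2)[OF x(2)] by auto
    then show "\<rho> = insert a \<tau> \<or> \<rho> = insert x (insert a \<tau>)" using x(4)[OF \<sigma>(1)] \<sigma>(2) by auto
  next
    have "insert a ` L' = insert a ` L - {insert a \<tau>, insert x (insert a \<tau>)}"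
      using inj_on_image_set_diff[OF inj, of L "{\<tau>, insert x \<tau>}"] x by (simp add: insert_commute)
    then show "D \<union> insert a ` L' = D \<union> insert a ` L - {insert a \<tau>, insert x (insert a \<tau>)}"
      using assms(3) by auto
  qed
qed

lemma face_collapses_cone:
  assumes "face_collapse\<^sup>*\<^sup>* L L'" "\<And>\<sigma>. \<sigma> \<in> L \<Longrightarrow> a \<notin> \<sigma>" "\<And>\<sigma>. \<sigma> \<in> D \<Longrightarrow> a \<notin> \<sigma>"
  shows "face_collapse\<^sup>*\<^sup>* (D \<union> insert a ` L) (D \<union> insert a ` L')"
  using assms(1)
proof (induction rule: rtranclp_induct)
  case (step M M')
  have "face_collapse (D \<union> insert a ` M) (D \<union> insert a ` M')"
    using face_collapse_cone[OF step.hyps(2) _ assms(3)] face_collapse_subset[OF step.hyps(1)] assms(2)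
    by blast
  then show ?case using step.IH by simp
qed simp

text \<open>The second cone is shrunk by removing the pairs \<open>\<tau>, insert b \<tau>\<close> with \<open>\<tau> \<notin> K\<close>, largest \<open>\<tau>\<close>
  first.\<close>

lemma face_collapses_suspension:
  assumes "finite T" "K \<subseteq> T" "\<And>\<sigma>. \<sigma> \<in> T \<Longrightarrow> finite \<sigma> \<and> a \<notin> \<sigma> \<and> b \<notin> \<sigma>" "a \<noteq> b" "simplicial K"
  shows "face_collapse\<^sup>*\<^sup>* (T \<union> insert b ` T \<union> insert a ` K) (K \<union> insert b ` K \<union> insert a ` K)"
  using assms
proof (induction "card (T - K)" arbitrary: T)
  case 0
  then have "T = K" by auto
  then show ?case by simp
next
  case (Suc n)
  then have "T - K \<noteq> {}" "finite (T - K)" by auto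
  \<comment> \<open>A face of largest cardinality, found by minimising the negated
    cardinality.\<close>
  then obtain \<tau> where \<tau>: "\<tau> \<in> T - K" and max: "\<And>\<sigma>. \<sigma> \<in> T - K \<Longrightarrow> card \<sigma> \<le> card \<tau>"
    using ex_min_if_finite[of "(\<lambda>\<sigma>. - int (card \<sigma>)) ` (T - K)"] by (auto simp: not_less)
  \<comment> \<open>A face above \<open>\<tau>\<close> cannot lie in the simplicial family
    \<open>K\<close>, so the choice of largest cardinality makes \<open>\<tau>\<close> maximal in
    \<open>T\<close>. Only \<open>insert b \<tau>\<close> then lies properly above it.\<close>
  have top: "\<sigma> = \<tau>" if "\<sigma> \<in> T" "\<tau> \<subseteq> \<sigma>" for \<sigma>
  proof -
    have "\<sigma> \<notin> K" using simplicialD[OF Suc.prems(5) _ that(2)] \<tau> by blast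
    then show ?thesis using that max[of \<sigma>] Suc.prems(3)[OF that(1)] by (metis DiffI card_seteq)
  qed
  have notin: "a \<notin> \<tau>" "b \<notin> \<tau>" using \<tau> Suc.prems(3) by auto
  let ?T = "T - {\<tau>}"
  have "face_collapse (T \<union> insert b ` T \<union> insert a ` K) (?T \<union> insert b ` ?T \<union> insert a ` K)"
    unfolding face_collapse_def
  proof (intro exI conjI ballI impI)
    show "b \<notin> \<tau>" by (rule notin)
    show "\<tau> \<in> T \<union> insert b ` T \<union> insert a ` K" "insert b \<tau> \<in> T \<union> insert b ` T \<union> insert a ` K"
      using \<tau> by auto
  next
    fix \<rho> assume \<rho>: "\<rho> \<in> T \<union> insert b ` T \<union> insert a ` K" "\<tau> \<subseteq> \<rho>"
    then consider "\<rho> \<in> T" | \<sigma> where "\<sigma> \<in> T" "\<rho> = insert b \<sigma>" | \<sigma> where "\<sigma> \<in> K" "\<rho> = insert a \<sigma>" by blast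
    then show "\<rho> = \<tau> \<or> \<rho> = insert b \<tau>"
    proof cases
      case 1
      then show ?thesis using top \<rho>(2) by blast
    next
      case 2
      then have "\<tau> \<subseteq> \<sigma>" using notin \<rho>(2) by auto
      then show ?thesis using top 2 by blast
    next
      case 3
      then have "\<tau> \<subseteq> \<sigma>" using notin \<rho>(2) by auto
      then show ?thesis using simplicialD[OF Suc.prems(5) 3(1)] \<tau> by blast
    qed
  next
    have "inj_on (insert b) T" using Suc.prems(3) by (meson inj_onI insert_ident)
    from inj_on_image_set_diff[OF this, of T "{\<tau>}"]
    have "insert b ` ?T = insert b ` T - {insert b \<tau>}" using \<tau> by simp
    moreover have "(A - {x}) \<union> (B - {y}) \<union> C = A \<union> B \<union> C - {x, y}"
      if "y \<notin> A" "x \<notin> B" "x \<notin> C" "y \<notin> C" for A B C :: "'a set set" and x y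
      using that by blast
    moreover have "insert b \<tau> \<notin> T" using Suc.prems(3) by blast
    moreover have "\<tau> \<notin> insert b ` T" "\<tau> \<notin> insert a ` K" "insert b \<tau> \<notin> insert a ` K"
      using notin Suc.prems(4) by blast+
    ultimately show "?T \<union> insert b ` ?T \<union> insert a ` K
      = T \<union> insert b ` T \<union> insert a ` K - {\<tau>, insert b \<tau>}"
      by presburger
  qed
  moreover have "face_collapse\<^sup>*\<^sup>* (?T \<union> insert b ` ?T \<union> insert a ` K) (K \<union> insert b ` K \<union> insert a ` K)"
  proof (rule Suc.hyps(1))
    have "?T - K = (T - K) - {\<tau>}" by blast
    then show "n = card (?T - K)" using Suc.hyps(2) \<tau> Suc.prems(1) by simp
  qed (use Suc.prems \<tau> in auto)
  ultimately show ?case by (rule converse_rtranclp_into_rtranclp)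
qed

section \<open>Cross-polytopes with labelled vertices\<close>

definition cross_faces :: "(nat \<Rightarrow> 'a) \<Rightarrow> nat \<Rightarrow> 'a set set" where
  "cross_faces g d = {\<sigma>. \<sigma> \<subseteq> g ` {1..2*d} \<and> (\<forall>i\<in>{1..d}. \<not> {g (2*i - 1), g (2*i)} \<subseteq> \<sigma>)}"

lemma simplicial_cross_faces: "simplicial (cross_faces g d)"
  unfolding simplicial_def
proof (intro ballI conjI allI impI)
  fix \<sigma> \<tau> assume \<sigma>: "\<sigma> \<in> cross_faces g d"
  then show "finite \<sigma>" by (auto simp: cross_faces_def intro: finite_subset)
  assume "\<tau> \<subseteq> \<sigma>"
  then show "\<tau> \<in> cross_faces g d" using \<sigma> unfolding cross_faces_def by blast
qed

lemma cross_pair_index: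
  fixes i d :: nat
  assumes "i \<in> {1..d}"
  shows "2*i - 1 \<in> {1..2*d}" "2*i \<in> {1..2*d}" "2*i - 1 \<noteq> 2*i"
  using assms by auto

lemma cross_pair_neq:
  fixes i d :: nat
  assumes "inj_on g {1..2*d}" "i \<in> {1..d}"
  shows "g (2*i - 1) \<noteq> g (2*i)"
  by (simp only: inj_on_eq_iff[OF assms(1)] cross_pair_index[OF assms(2)]) simp

lemma singleton_in_cross_faces:
  assumes "inj_on g {1..2*d}"
  shows "{x} \<in> cross_faces g d \<longleftrightarrow> x \<in> g ` {1..2*d}"
proof -
  have "\<not> {g (2*i - 1), g (2*i)} \<subseteq> {x}" if "i \<in> {1..d}" for i
    using cross_pair_neq[OF assms that] by (simp only: insert_subset singleton_iff) metis
  then show ?thesis by (simp only: cross_faces_def mem_Collect_eq) simp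
qed

text \<open>Suspending with the new antipodal pair \<open>a\<close>, \<open>b\<close>, stored at
  positions \<open>2*d + 1\<close> and \<open>2*d + 2\<close>, gives the next cross-polytope: a face
  contains at most one of the two, and removing it leaves an old face. The union has the shape
  produced by \<open>face_collapses_suspension\<close>.\<close>

lemma cross_faces_Suc:
  fixes g :: "nat \<Rightarrow> 'a"
  assumes "a \<notin> g ` {1..2*d}" "b \<notin> g ` {1..2*d}" "a \<noteq> b"
  defines "h \<equiv> g(2*d + 1 := a, 2*d + 2 := b)"
  shows "cross_faces h (Suc d)
    = cross_faces g d \<union> insert b ` cross_faces g d \<union> insert a ` cross_faces g d"
proof -
  have W: "h ` {1..2 * Suc d} = insert a (insert b (g ` {1..2*d}))"
  proof -
    have "{1..2 * Suc d} = insert (2*d + 1) (insert (2*d + 2) {1..2*d})" by auto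
    moreover have "h ` {1..2*d} = g ` {1..2*d}" by (rule image_cong) (auto simp: h_def)
    moreover have "h (2*d + 1) = a" "h (2*d + 2) = b" by (simp_all add: h_def)
    ultimately show ?thesis by (simp only: image_insert)
  qed
  have pairs: "(\<forall>i\<in>{1..Suc d}. \<not> {h (2*i - 1), h (2*i)} \<subseteq> \<sigma>) \<longleftrightarrow>
    \<not> {a, b} \<subseteq> \<sigma> \<and> (\<forall>i\<in>{1..d}. \<not> {g (2*i - 1), g (2*i)} \<subseteq> \<sigma>)" for \<sigma>
  proof -
    have "{1..Suc d} = insert (Suc d) {1..d}" by auto
    moreover have "h (2*i - 1) = g (2*i - 1)" "h (2*i) = g (2*i)" if "i \<in> {1..d}" for i
      using that by (auto simp: h_def)
    moreover have "h (2 * Suc d - 1) = a" "h (2 * Suc d) = b" by (simp_all add: h_def)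
    ultimately show ?thesis by (simp only: ball_simps) (metis (no_types, lifting))
  qed
  have g: "g (2*i - 1) \<in> g ` {1..2*d}" "g (2*i) \<in> g ` {1..2*d}" if "i \<in> {1..d}" for i
    using cross_pair_index[OF that] by blast+
  have ext: "insert c \<sigma> \<in> cross_faces h (Suc d)"
    if "\<sigma> \<in> cross_faces g d" "c = a \<or> c = b" for c \<sigma>
  proof -
    have \<sigma>: "\<sigma> \<subseteq> g ` {1..2*d}" "\<forall>i\<in>{1..d}. \<not> {g (2*i - 1), g (2*i)} \<subseteq> \<sigma>"
      using that(1) unfolding cross_faces_def by blast+
    have "\<not> {a, b} \<subseteq> insert c \<sigma>" using \<sigma>(1) assms(1-3) that(2) by blast
    moreover have "\<not> {g (2*i - 1), g (2*i)} \<subseteq> insert c \<sigma>" if "i \<in> {1..d}" for i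
      using g[OF that] \<open>c = a \<or> c = b\<close> \<sigma>(2) assms(1,2) that by blast
    ultimately show ?thesis
      using that(2) \<sigma>(1) unfolding cross_faces_def W mem_Collect_eq pairs by blast
  qed
  have sub: "cross_faces g d \<subseteq> cross_faces h (Suc d)"
    using assms(1,2) unfolding cross_faces_def W pairs by blast
  have res: "\<sigma> - {a, b} \<in> cross_faces g d" "\<not> {a, b} \<subseteq> \<sigma>" if "\<sigma> \<in> cross_faces h (Suc d)" for \<sigma>
    using that unfolding cross_faces_def W mem_Collect_eq pairs by blast+
  have "\<sigma> \<in> cross_faces g d \<union> insert b ` cross_faces g d \<union> insert a ` cross_faces g d"
    if "\<sigma> \<in> cross_faces h (Suc d)" for \<sigma>
  proof -
    have "\<sigma> = \<sigma> - {a, b} \<or> \<sigma> = insert b (\<sigma> - {a, b}) \<or> \<sigma> = insert a (\<sigma> - {a, b})"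
      using res(2)[OF that] by blast
    then show ?thesis using imageI[OF res(1)[OF that]] res(1)[OF that] by (metis UnI1 UnI2)
  qed
  moreover have "cross_faces g d \<union> insert b ` cross_faces g d \<union> insert a ` cross_faces g d
    \<subseteq> cross_faces h (Suc d)" using ext sub by auto
  ultimately show ?thesis by (intro subset_antisym subsetI) auto
qed

lemma inj_on_extend_two:
  assumes "inj_on g {1..2*d}" "a \<notin> g ` {1..2*d}" "b \<notin> g ` {1..2*d}" "a \<noteq> b"
  shows "inj_on (g(2*d + 1 := a, 2*d + 2 := b)) {1..2 * Suc d}"
proof (rule inj_onI)
  let ?h = "g(2*d + 1 := a, 2*d + 2 := b)"
  fix i j assume ij: "i \<in> {1..2 * Suc d}" "j \<in> {1..2 * Suc d}" "?h i = ?h j"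
  have "k \<in> {1..2*d} \<or> k = 2*d + 1 \<or> k = 2*d + 2" if "k \<in> {1..2 * Suc d}" for k
    using that by auto
  moreover have "?h k = g k" if "k \<in> {1..2*d}" for k using that by auto
  moreover have "?h (2*d + 1) = a" "?h (2*d + 2) = b" by simp_all
  ultimately show "i = j" using ij assms(2-4) inj_onD[OF assms(1), of i j] by (metis imageI)
qed

text \<open>Two stages: first the link of \<open>a\<close> is collapsed to a cross-polytope inside
  the cone with apex \<open>a\<close>, leaving the deletion untouched; then the cone with apex
  \<open>b\<close> is shrunk to the cone over the same cross-polytope.\<close>

lemma iterated_suspension_collapses:
  assumes "iterated_suspension \<Delta> d" "simplicial \<Delta>" "finite \<Delta>"
  shows "\<exists>g. inj_on g {1..2*d} \<and> face_collapse\<^sup>*\<^sup>* \<Delta> (cross_faces g d)"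
  using assms
proof (induction rule: iterated_suspension.induct)
  case base
  have "cross_faces g 0 = {{}}" for g :: "nat \<Rightarrow> 'a" by (auto simp: cross_faces_def)
  then show ?case by auto
next
  case (step a \<Delta> b d)
  have "{} \<in> \<Delta>" using simplicialD[OF step.prems(1) step.hyps(1)] by simp
  then have ab: "a \<noteq> b" using cone_deletionD[OF step.hyps(3)] by blast
  have sub: "link \<Delta> a \<subseteq> deletion \<Delta> a" by (rule link_subset[OF step.prems(1)])
  have "finite (link \<Delta> a)"
    using finite_subset[OF sub] step.prems(2) by (simp add: deletion_def)
  from step.IH[OF simplicial_link[OF step.prems(1)] this]
  obtain g where g: "inj_on g {1..2*d}" "face_collapse\<^sup>*\<^sup>* (link \<Delta> a) (cross_faces g d)" by blast
  let ?K = "cross_faces g d" and ?h = "g(2*d + 1 := a, 2*d + 2 := b)"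
  have K: "?K \<subseteq> link \<Delta> a" using face_collapse_subset[OF g(2)] .
  \<comment> \<open>Since the poles do not span a face, \<open>b\<close> is no vertex of the link,
    and both poles are fresh labels for \<open>g\<close>.\<close>
  have b_link: "b \<notin> \<sigma>" if "\<sigma> \<in> link \<Delta> a" for \<sigma>
    using that step.hyps(2) simplicialD[OF step.prems(1), of "insert a \<sigma>" "{a, b}"]
    by (auto simp: link_def)
  have vertex: "{x} \<in> ?K" if "x \<in> g ` {1..2*d}" for x
    using that by (simp only: singleton_in_cross_faces[OF g(1)])
  have a_notin: "a \<notin> g ` {1..2*d}" and b_notin: "b \<notin> g ` {1..2*d}"
    using vertex[of a] vertex[of b] K b_link[of "{b}"] unfolding link_def by blast+
  \<comment> \<open>The base of the cone with apex \<open>b\<close> that makes up the deletion of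
    \<open>a\<close>.\<close>
  define T where "T = {\<sigma> \<in> deletion \<Delta> a. b \<notin> \<sigma>}"
  have del: "deletion \<Delta> a = T \<union> insert b ` T"
  proof
    show "T \<union> insert b ` T \<subseteq> deletion \<Delta> a"
      using step.hyps(3) by (auto simp: T_def cone_apex_def)
    show "deletion \<Delta> a \<subseteq> T \<union> insert b ` T"
    proof
      fix \<sigma> assume \<sigma>: "\<sigma> \<in> deletion \<Delta> a"
      show "\<sigma> \<in> T \<union> insert b ` T"
      proof (cases "b \<in> \<sigma>")
        case True
        then have "\<sigma> = insert b (\<sigma> - {b})" "\<sigma> - {b} \<in> T"
          using simplicialD[OF simplicial_deletion[OF step.prems(1)] \<sigma>] by (auto simp: T_def)
        then show ?thesis by blast
      qed (use \<sigma> in \<open>simp add: T_def\<close>)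
    qed
  qed
  have split: "\<Delta> = deletion \<Delta> a \<union> insert a ` link \<Delta> a"
  proof
    show "deletion \<Delta> a \<union> insert a ` link \<Delta> a \<subseteq> \<Delta>" by (auto simp: deletion_def link_def)
    show "\<Delta> \<subseteq> deletion \<Delta> a \<union> insert a ` link \<Delta> a"
    proof
      fix \<sigma> assume \<sigma>: "\<sigma> \<in> \<Delta>"
      show "\<sigma> \<in> deletion \<Delta> a \<union> insert a ` link \<Delta> a"
      proof (cases "a \<in> \<sigma>")
        case True
        then have "\<sigma> = insert a (\<sigma> - {a})" "\<sigma> - {a} \<in> link \<Delta> a" using \<sigma> by (auto simp: link_def insert_absorb)
        then show ?thesis by blast
      qed (use \<sigma> in \<open>simp add: deletion_def\<close>)
    qed
  qed
  have "face_collapse\<^sup>*\<^sup>* (deletion \<Delta> a \<union> insert a ` link \<Delta> a) (deletion \<Delta> a \<union> insert a ` ?K)"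
    by (rule face_collapses_cone[OF g(2)]) (auto simp: link_def deletion_def)
  then have "face_collapse\<^sup>*\<^sup>* \<Delta> (T \<union> insert b ` T \<union> insert a ` ?K)"
    using split del by simp
  also have "face_collapse\<^sup>*\<^sup>* (T \<union> insert b ` T \<union> insert a ` ?K) (?K \<union> insert b ` ?K \<union> insert a ` ?K)"
  proof (rule face_collapses_suspension)
    show "finite T" using step.prems(2) by (simp add: T_def deletion_def)
    show "?K \<subseteq> T" using K sub b_link by (auto simp: T_def)
    show "finite \<sigma> \<and> a \<notin> \<sigma> \<and> b \<notin> \<sigma>" if "\<sigma> \<in> T" for \<sigma>
      using that step.prems(1) by (auto simp: T_def deletion_def simplicial_def)
  qed (auto simp: ab simplicial_cross_faces)
  finally have "face_collapse\<^sup>*\<^sup>* \<Delta> (cross_faces ?h (Suc d))"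
    using cross_faces_Suc[OF a_notin b_notin ab] by simp
  moreover have "inj_on ?h {1..2 * Suc d}"
    by (rule inj_on_extend_two[OF g(1) a_notin b_notin ab])
  ultimately show ?case by blast
qed

section \<open>Comparison with the standard boundary of the cross-polytope\<close>

lemma cross_polytope_boundary_eq: "cross_polytope_boundary d = mon_of ` cross_faces id d"
proof -
  let ?X = "{1..2*d}" and ?G = "(\<lambda>i. {2*i - 1, 2*i}) ` {1..d}"
  have "(\<lambda>i. Var (2*i - 1) * Var (2*i)) ` {1..d} = (\<lambda>g. \<Prod>x\<in>g. Var x) ` ?G"
    unfolding image_image by (rule image_cong) auto
  moreover have "?G \<subseteq> Pow ?X" by auto
  ultimately have "cross_polytope_boundary d
      = complex_of ?X (sr_ideal ?X {\<sigma>. \<sigma> \<subseteq> ?X \<and> (\<forall>g\<in>?G. \<not> g \<subseteq> \<sigma>)})"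
    using genideal_squares_eq_sr_ideal[of ?X ?G] by (simp add: cross_polytope_boundary_def Un_commute)
  also have "{\<sigma>. \<sigma> \<subseteq> ?X \<and> (\<forall>g\<in>?G. \<not> g \<subseteq> \<sigma>)} = cross_faces id d"
    by (simp add: cross_faces_def)
  also have "complex_of ?X (sr_ideal ?X (cross_faces id d)) = mon_of ` cross_faces id d"
    by (rule complex_of_sr_ideal[OF simplicial_cross_faces]) (auto simp: cross_faces_def)
  finally show ?thesis .
qed

lemma cross_faces_image:
  assumes "inj_on g {1..2*d}"
  shows "cross_faces g d = (`) g ` cross_faces id d"
proof -
  have "{g (2*i - 1), g (2*i)} \<subseteq> g ` \<sigma> \<longleftrightarrow> {2*i - 1, 2*i} \<subseteq> \<sigma>"
    if "i \<in> {1..d}" "\<sigma> \<subseteq> {1..2*d}" for i \<sigma>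
    using inj_on_image_mem_iff[OF assms _ that(2)] cross_pair_index[OF that(1)] by simp
  then have "g ` \<sigma> \<in> cross_faces g d \<longleftrightarrow> \<sigma> \<in> cross_faces id d" if "\<sigma> \<subseteq> {1..2*d}" for \<sigma>
    using that image_mono[OF that, of g] unfolding cross_faces_def id_apply image_ident mem_Collect_eq
    by blast
  moreover have "\<sigma> \<subseteq> {1..2*d}" if "\<sigma> \<in> cross_faces id d" for \<sigma>
    using that by (simp add: cross_faces_def)
  moreover have "\<exists>\<tau>\<subseteq>{1..2*d}. \<sigma> = g ` \<tau>" if "\<sigma> \<in> cross_faces g d" for \<sigma>
    using that by (auto simp: cross_faces_def subset_image_iff)
  ultimately show ?thesis by (intro subset_antisym subsetI) (metis imageI, metis imageE)
qed

lemma complex_vertices_cross_faces: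
  assumes "inj_on g {1..2*d}"
  shows "complex_vertices (mon_of ` cross_faces g d) = g ` {1..2*d}"
proof -
  have "complex_vertices (mon_of ` cross_faces g d) = {x. {x} \<in> cross_faces g d}"
    unfolding complex_vertices_def
    using mon_of_image_iff[OF simplicial_cross_faces, of "{x}" g d for x] by simp
  also have "\<dots> = g ` {1..2*d}"
    by (simp only: singleton_in_cross_faces[OF assms]) simp
  finally show ?thesis .
qed

text \<open>Injectivity on the support keeps exponents from adding up under renaming.\<close>

lemma rename_mon_mon_of:
  assumes "finite \<sigma>" "inj_on f \<sigma>"
  shows "rename_mon f (mon_of \<sigma>) = mon_of (f ` \<sigma>)"
  unfolding rename_mon_def using assms
  by (simp add: lookup_mon_of mon_of_def[of "f ` \<sigma>"] sum.reindex)

lemma complex_iso_cross_faces: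
  assumes "inj_on g {1..2*d}"
  shows "complex_iso (mon_of ` cross_faces g d) (cross_polytope_boundary d)"
  unfolding complex_iso_def cross_polytope_boundary_eq
proof (intro exI conjI)
  \<comment> \<open>The isomorphism leads from the labelled vertices back to the indices;
    \<open>g\<close> is injective on the index range, so the inverse is taken there.\<close>
  let ?f = "inv_into {1..2*d} g"
  show "bij_betw ?f (complex_vertices (mon_of ` cross_faces g d))
      (complex_vertices (mon_of ` cross_faces id d))"
    using assms complex_vertices_cross_faces[of id d]
    by (simp add: complex_vertices_cross_faces inj_on_imp_bij_betw bij_betw_inv_into)
  have "rename_mon ?f (mon_of (g ` \<sigma>)) = mon_of \<sigma>" if "\<sigma> \<in> cross_faces id d" for \<sigma>
  proof -
    have \<sigma>: "\<sigma> \<subseteq> {1..2*d}" using that by (simp add: cross_faces_def)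
    have "rename_mon ?f (mon_of (g ` \<sigma>)) = mon_of (?f ` g ` \<sigma>)"
      using \<sigma> finite_subset[OF \<sigma>]
      by (intro rename_mon_mon_of) (auto intro: inj_on_inv_into)
    also have "?f ` g ` \<sigma> = \<sigma>" using inv_into_image_cancel[OF assms \<sigma>] .
    finally show ?thesis .
  qed
  then show "rename_mon ?f ` mon_of ` cross_faces g d = mon_of ` cross_faces id d"
    unfolding cross_faces_image[OF assms] image_image by (rule image_cong[OF refl])
qed

section \<open>Dominance complexes of forests\<close>

text \<open>For a simple graph these are the complements in \<open>V\<close> of the dominating
  sets.\<close>

definition dominance_faces :: "'a set \<Rightarrow> 'a set set \<Rightarrow> 'a set set" where
  "dominance_faces V E = {\<sigma>. \<sigma> \<subseteq> V \<and> (\<forall>v\<in>V. \<not> closed_nbhd E v \<subseteq> \<sigma>)}"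

lemma simplicial_dominance_faces:
  assumes "finite V"
  shows "simplicial (dominance_faces V E)"
  unfolding simplicial_def
proof (intro ballI conjI allI impI)
  fix \<sigma> \<tau> assume \<sigma>: "\<sigma> \<in> dominance_faces V E"
  then show "finite \<sigma>" using assms by (auto simp: dominance_faces_def intro: finite_subset)
  assume "\<tau> \<subseteq> \<sigma>"
  then show "\<tau> \<in> dominance_faces V E" using \<sigma> unfolding dominance_faces_def by blast
qed

lemma simple_graphD:
  assumes "simple_graph V E" "{u, v} \<in> E"
  shows "u \<in> V" "v \<in> V" "u \<noteq> v"
  using assms by (auto simp: simple_graph_def)

lemma star_ideal_eq_sr_ideal:
  assumes "simple_graph V E"
  shows "star_ideal V E = sr_ideal V (dominance_faces V E)"
proof -
  have "closed_nbhd E ` V \<subseteq> Pow V"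
    using simple_graphD(1)[OF assms] by (auto simp: closed_nbhd_def)
  moreover have "finite V" using assms by (simp add: simple_graph_def)
  ultimately show ?thesis
    using genideal_squares_eq_sr_ideal[of V "closed_nbhd E ` V"]
    by (simp add: star_ideal_def dominance_faces_def image_image)
qed

text \<open>An endpoint of a longest path is a leaf: a further neighbour would either prolong the path
  or close a cycle.\<close>

lemma forest_leaf:
  assumes "forest V E" "E \<noteq> {}"
  obtains l p where "{l, p} \<in> E" "\<And>u. {u, l} \<in> E \<Longrightarrow> u = p"
proof -
  have graph: "simple_graph V E" and acyclic: "\<And>vs. \<not> graph_cycle E vs"
    using assms(1) by (auto simp: forest_def)
  have finV: "finite V" using graph by (simp add: simple_graph_def)
  define path where "path xs \<longleftrightarrow> distinct xs \<and> set xs \<subseteq> V \<and>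
    (\<forall>i. Suc i < length xs \<longrightarrow> {xs ! i, xs ! Suc i} \<in> E)" for xs
  obtain e where "e \<in> E" using assms(2) by blast
  then have "card e = 2" using graph by (simp add: simple_graph_def)
  then obtain u v where "e = {u, v}" by (auto simp: card_2_iff)
  with \<open>e \<in> E\<close> have uv: "{u, v} \<in> E" by simp
  have path_uv: "path [u, v]" using simple_graphD[OF graph uv] uv by (auto simp: path_def less_Suc_eq)
  have "length xs < Suc (card V)" if "path xs" for xs
    using that finV by (metis path_def card_mono distinct_card less_Suc_eq_le)
  then obtain xs where xs: "path xs" and max: "\<And>ys. path ys \<Longrightarrow> length ys \<le> length xs"
    using ex_has_greatest_nat[of path "[u, v]" length "Suc (card V)"] path_uv by blast
  have len: "2 \<le> length xs" using max[OF path_uv] by simp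
  let ?l = "xs ! 0" and ?p = "xs ! 1"
  have "{?l, ?p} \<in> E" using xs len by (simp add: path_def)
  moreover have "w = ?p" if w: "{w, ?l} \<in> E" for w
  proof (rule ccontr)
    assume wp: "w \<noteq> ?p"
    have "w \<in> set xs"
    proof (rule ccontr)
      assume "w \<notin> set xs"
      then have "path (w # xs)"
        using xs w simple_graphD(1)[OF graph w] unfolding path_def
        by (auto simp: nth_Cons split: nat.splits)
      then show False using max by fastforce
    qed
    then obtain i where i: "i < length xs" "xs ! i = w" by (auto simp: in_set_conv_nth)
    have "w \<noteq> ?l" using simple_graphD(3)[OF graph w] .
    \<comment> \<open>The neighbour \<open>w\<close> is neither of the first two vertices, so the
      initial segment up to \<open>w\<close> has at least three vertices; the edge from
      \<open>w\<close> back to the start closes it to a cycle.\<close>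
    then have "2 \<le> i" using i wp by (cases "i = 0"; cases "i = 1") auto
    have "graph_cycle E (take (Suc i) xs)"
      unfolding graph_cycle_def
    proof (intro conjI allI impI)
      show "3 \<le> length (take (Suc i) xs)" using \<open>2 \<le> i\<close> i by simp
      show "distinct (take (Suc i) xs)" using xs by (simp add: path_def)
      fix k assume "k < length (take (Suc i) xs)"
      then have "k < i \<or> k = i" using i by auto
      then show "{take (Suc i) xs ! k, take (Suc i) xs ! (Suc k mod length (take (Suc i) xs))} \<in> E"
      proof
        assume "k < i"
        then show ?thesis using xs i by (simp add: path_def)
      next
        assume "k = i"
        then show ?thesis using i w by simp
      qed
    qed
    then show False using acyclic by blast
  qed
  ultimately show thesis using that by blast
qed

text \<open>Only the edges at \<open>p\<close> go; \<open>p\<close> stays as an isolated vertex, so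
  the set of variables is the same throughout the induction.\<close>

lemma forest_remove_vertex: "forest V E \<Longrightarrow> forest V {e \<in> E. p \<notin> e}"
  by (fastforce simp: forest_def simple_graph_def graph_cycle_def)

lemma link_dominance_faces:
  assumes "simple_graph V E" "{l, p} \<in> E" "\<And>u. {u, l} \<in> E \<Longrightarrow> u = p"
  shows "link (dominance_faces V E) p = dominance_faces V {e \<in> E. p \<notin> e}"
proof -
  let ?E = "{e \<in> E. p \<notin> e}"
  have lp: "l \<in> V" "p \<in> V" "l \<noteq> p" using simple_graphD[OF assms(1,2)] by auto
  have nbhd: "closed_nbhd ?E v = closed_nbhd E v - {p}" if "v \<noteq> p" for v
    using that by (auto simp: closed_nbhd_def)
  have nbhd_p: "closed_nbhd ?E p = {p}" by (auto simp: closed_nbhd_def)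
  have nbhd_l: "closed_nbhd ?E l = {l}" using nbhd[of l] lp assms(3) by (auto simp: closed_nbhd_def)
  have l_p: "l \<in> closed_nbhd E p" using assms(2) by (simp add: closed_nbhd_def)
  show ?thesis
  proof (intro subset_antisym subsetI)
    fix \<sigma> assume "\<sigma> \<in> link (dominance_faces V E) p"
    then have \<sigma>: "p \<notin> \<sigma>" "\<sigma> \<subseteq> V" "\<And>v. v \<in> V \<Longrightarrow> \<not> closed_nbhd E v \<subseteq> insert p \<sigma>"
      by (auto simp: link_def dominance_faces_def)
    have "\<not> closed_nbhd ?E v \<subseteq> \<sigma>" if "v \<in> V" for v
    proof (cases "v = p")
      case True
      then show ?thesis using \<sigma>(1) nbhd_p by simp
    next
      case False
      then show ?thesis using \<sigma>(3)[OF that] nbhd[OF False] by blast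
    qed
    then show "\<sigma> \<in> dominance_faces V ?E" using \<sigma>(2) by (simp add: dominance_faces_def)
  next
    fix \<sigma> assume "\<sigma> \<in> dominance_faces V ?E"
    then have \<sigma>: "\<sigma> \<subseteq> V" "\<And>v. v \<in> V \<Longrightarrow> \<not> closed_nbhd ?E v \<subseteq> \<sigma>"
      by (auto simp: dominance_faces_def)
    \<comment> \<open>In the smaller graph both \<open>p\<close> and \<open>l\<close> are isolated,
      so their closed neighbourhoods are singletons and a face avoids both. The absence of
      \<open>l\<close> then prevents the old neighbourhood of \<open>p\<close> from being contained
      in \<open>insert p \<sigma>\<close>.\<close>
    have notin: "p \<notin> \<sigma>" "l \<notin> \<sigma>" using \<sigma>(2)[of p] \<sigma>(2)[of l] lp nbhd_p nbhd_l by auto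
    have "\<not> closed_nbhd E v \<subseteq> insert p \<sigma>" if "v \<in> V" for v
    proof (cases "v = p")
      case True
      then show ?thesis using l_p notin lp by blast
    next
      case False
      then show ?thesis using \<sigma>(2)[OF that] nbhd[OF False] by blast
    qed
    then show "\<sigma> \<in> link (dominance_faces V E) p"
      using \<sigma>(1) lp notin by (simp add: link_def dominance_faces_def)
  qed
qed

text \<open>The poles are \<open>p\<close> and the leaf \<open>l\<close>. The only closed
  neighbourhoods containing \<open>l\<close> are those of \<open>l\<close> and \<open>p\<close>, and
  both contain \<open>p\<close>; so a face avoiding \<open>p\<close> can always be enlarged by
  \<open>l\<close>.\<close>

lemma iterated_suspension_dominance_faces_step:
  assumes "simple_graph V E" "{l, p} \<in> E" "\<And>u. {u, l} \<in> E \<Longrightarrow> u = p"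
    "iterated_suspension (dominance_faces V {e \<in> E. p \<notin> e}) d"
  shows "iterated_suspension (dominance_faces V E) (Suc d)"
proof (rule iterated_suspension.step[of p _ l])
  have lp: "l \<in> V" "p \<in> V" "l \<noteq> p" using simple_graphD[OF assms(1,2)] by auto
  have l_p: "l \<in> closed_nbhd E p" using assms(2) by (simp add: closed_nbhd_def)
  have v_v: "v \<in> closed_nbhd E v" for v by (simp add: closed_nbhd_def)
  have "\<not> closed_nbhd E v \<subseteq> {p}" for v using l_p v_v[of v] lp by blast
  then show "{p} \<in> dominance_faces V E" using lp by (simp add: dominance_faces_def)
  have "closed_nbhd E l \<subseteq> {p, l}" using assms(3) by (auto simp: closed_nbhd_def)
  then show "{p, l} \<notin> dominance_faces V E" using lp unfolding dominance_faces_def by blast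
  show "cone_apex (deletion (dominance_faces V E) p) l"
  proof (rule cone_deletionI)
    show "p \<noteq> l" using lp by simp
    fix \<sigma> assume \<sigma>: "\<sigma> \<in> dominance_faces V E" "p \<notin> \<sigma>"
    have "\<not> closed_nbhd E v \<subseteq> insert l \<sigma>" if "v \<in> V" for v
    proof
      assume sub: "closed_nbhd E v \<subseteq> insert l \<sigma>"
      have "\<not> closed_nbhd E v \<subseteq> \<sigma>" using \<sigma>(1) that by (simp add: dominance_faces_def)
      then have "l \<in> closed_nbhd E v" using sub by blast
      then have "v = l \<or> v = p" using assms(3)[of v] by (auto simp: closed_nbhd_def insert_commute)
      then have "p \<in> closed_nbhd E v" using assms(2) by (auto simp: closed_nbhd_def insert_commute)
      then show False using sub \<sigma>(2) lp by blast
    qed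
    then show "insert l \<sigma> \<in> dominance_faces V E"
      using \<sigma>(1) lp by (simp add: dominance_faces_def)
  qed
  show "iterated_suspension (link (dominance_faces V E) p) d"
    using assms(4) link_dominance_faces[OF assms(1-3)] by simp
qed

section \<open>Matchings and vertex covers\<close>

lemma disjoint_insert_leaf_edge:
  assumes "simple_graph V E" "{l, p} \<in> E" "\<And>u. {u, l} \<in> E \<Longrightarrow> u = p"
    "M \<subseteq> {e \<in> E. p \<notin> e}" "disjoint M"
  shows "disjoint (insert {l, p} M)" "{l, p} \<notin> M"
proof -
  have "e \<inter> {l, p} = {}" if "e \<in> M" for e
  proof -
    have e: "e \<in> E" "p \<notin> e" using that assms(4) by auto
    then have "card e = 2" using assms(1) by (simp add: simple_graph_def)
    then obtain x y where "e = {x, y}" by (auto simp: card_2_iff)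
    \<comment> \<open>An edge at the leaf would have \<open>p\<close> as its other end.\<close>
    then have "l \<notin> e" using e assms(3)[of x] assms(3)[of y] by (auto simp: insert_commute)
    then show ?thesis using e by blast
  qed
  then show "disjoint (insert {l, p} M)"
    using assms(5) by (auto simp: disjoint_def Int_commute)
  show "{l, p} \<notin> M" using assms(4) by blast
qed

text \<open>One induction produces all the data: each leaf edge enters the matching and its endpoint
  \<open>p\<close> the cover. For the cover an upper bound is recorded, since \<open>p\<close> might
  already belong to \<open>C\<close>; equality comes later from comparing matchings with
  covers.\<close>

lemma forest_iterated_suspension:
  assumes "forest V E"
  shows "\<exists>d M C. iterated_suspension (dominance_faces V E) d \<and> M \<subseteq> E \<and> disjoint M \<and> card M = d \<and>
    C \<subseteq> V \<and> (\<forall>e\<in>E. e \<inter> C \<noteq> {}) \<and> card C \<le> d"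
proof -
  have "finite V" using assms by (simp add: forest_def simple_graph_def)
  have "E \<subseteq> Pow V" using assms by (auto simp: forest_def simple_graph_def)
  then have "finite E" using \<open>finite V\<close> by (auto intro: finite_subset)
  then show ?thesis using assms
  proof (induction E rule: finite_psubset_induct)
    case (psubset E)
    show ?case
    proof (cases "E = {}")
      case True
      \<comment> \<open>Without edges each closed neighbourhood is a singleton, so no vertex can
        belong to a face.\<close>
      have "dominance_faces V E = {{}}"
        unfolding True dominance_faces_def closed_nbhd_def by auto
      then have "iterated_suspension (dominance_faces V E) 0" by (simp add: iterated_suspension_0)
      then show ?thesis using True by (intro exI[of _ 0] exI[of _ "{}"]) simp
    next
      case False
      obtain l p where lp: "{l, p} \<in> E" "\<And>u. {u, l} \<in> E \<Longrightarrow> u = p"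
        using forest_leaf[OF psubset.prems False] by metis
      let ?E = "{e \<in> E. p \<notin> e}"
      have graph: "simple_graph V E" using psubset.prems by (simp add: forest_def)
      have "?E \<subset> E" using lp(1) by blast
      from psubset.IH[OF this forest_remove_vertex[OF psubset.prems]]
      obtain d M C where IH: "iterated_suspension (dominance_faces V ?E) d" "M \<subseteq> ?E" "disjoint M"
        "card M = d" "C \<subseteq> V" "\<forall>e\<in>?E. e \<inter> C \<noteq> {}" "card C \<le> d" by blast
      have M: "disjoint (insert {l, p} M)" "{l, p} \<notin> M"
        using disjoint_insert_leaf_edge[OF graph lp IH(2,3)] by auto
      have "finite M" using IH(2) psubset.hyps by (auto intro: finite_subset)
      show ?thesis
      proof (intro exI conjI)
        show "iterated_suspension (dominance_faces V E) (Suc d)"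
          by (rule iterated_suspension_dominance_faces_step[OF graph lp IH(1)])
        show "insert {l, p} M \<subseteq> E" using lp(1) IH(2) by blast
        show "disjoint (insert {l, p} M)" by (rule M(1))
        show "card (insert {l, p} M) = Suc d" using M(2) \<open>finite M\<close> IH(4) by simp
        show "insert p C \<subseteq> V" using IH(5) simple_graphD(2)[OF graph lp(1)] by simp
        show "\<forall>e\<in>E. e \<inter> insert p C \<noteq> {}" using IH(6) by auto
        show "card (insert p C) \<le> Suc d" using card_insert_le_m1[of "Suc d" C p] IH(7) by simp
      qed
    qed
  qed
qed

text \<open>Choosing a covering vertex on each matching edge is injective because the edges are
  disjoint.\<close>

lemma matching_le_cover:
  assumes "disjoint M" "\<forall>e\<in>M. e \<inter> C \<noteq> {}" "finite C"
  shows "card M \<le> card C"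
proof -
  have "\<exists>f. \<forall>e\<in>M. f e \<in> e \<inter> C" using assms(2) by (intro bchoice) blast
  then obtain f where f: "\<And>e. e \<in> M \<Longrightarrow> f e \<in> e \<inter> C" by blast
  have "inj_on f M"
  proof (rule inj_onI, rule ccontr)
    fix e e' assume e: "e \<in> M" "e' \<in> M" "f e = f e'" "e \<noteq> e'"
    then have "e \<inter> e' = {}" using assms(1) by (auto simp: disjoint_def)
    then show False using f[OF e(1)] f[OF e(2)] e(3) by auto
  qed
  moreover have "f ` M \<subseteq> C" using f by blast
  ultimately show ?thesis using assms(3) card_inj_on_le by blast
qed

text \<open>Every matching is at most as large as every cover, so a matching and a cover with
  \<open>card C \<le> card M\<close> are both optimal.\<close>

lemma matching_number_vertex_cover_number:
  assumes "simple_graph V E" "M \<subseteq> E" "disjoint M" "C \<subseteq> V" "\<forall>e\<in>E. e \<inter> C \<noteq> {}" "card C \<le> card M"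
  shows "matching_number E = card M" "vertex_cover_number V E = card M"
proof -
  have "finite V" using assms(1) by (simp add: simple_graph_def)
  moreover have "E \<subseteq> Pow V" using assms(1) by (auto simp: simple_graph_def)
  ultimately have fin: "finite V" "finite E" "finite C"
    using assms(4) by (auto intro: finite_subset)
  have le: "card N \<le> card D"
    if "N \<subseteq> E" "disjoint N" "D \<subseteq> V" "\<forall>e\<in>E. e \<inter> D \<noteq> {}" for N D
    using matching_le_cover[OF that(2), of D] that finite_subset[OF that(3) fin(1)] by blast
  have CM: "card C = card M" using le[OF assms(2-5)] assms(6) by simp
  show "matching_number E = card M"
    unfolding matching_number_def
  proof (rule Max_eqI)
    show "finite (card ` {M. M \<subseteq> E \<and> disjoint M})" using fin(2) by simp
    show "y \<le> card M" if "y \<in> card ` {M. M \<subseteq> E \<and> disjoint M}" for y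
      using that le[OF _ _ assms(4,5)] CM by auto
    show "card M \<in> card ` {M. M \<subseteq> E \<and> disjoint M}" using assms(2,3) by blast
  qed
  show "vertex_cover_number V E = card M"
    unfolding vertex_cover_number_def
  proof (rule Min_eqI)
    show "finite (card ` {C. C \<subseteq> V \<and> (\<forall>e\<in>E. e \<inter> C \<noteq> {})})" using fin(1) by simp
    show "card M \<le> y" if "y \<in> card ` {C. C \<subseteq> V \<and> (\<forall>e\<in>E. e \<inter> C \<noteq> {})}" for y
      using that le[OF assms(2,3)] by blast
    show "card M \<in> card ` {C. C \<subseteq> V \<and> (\<forall>e\<in>E. e \<inter> C \<noteq> {})}"
      using assms(4,5) unfolding CM[symmetric] by blast
  qed
qed

theorem theorem8p1:
  fixes V :: "'a set" and E :: "'a set set"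
  assumes "forest V E"
  shows "simple_ideal V (star_ideal V E) \<and>
    (\<exists>K. collapses_onto (complex_of V (star_ideal V E)) K \<and>
         complex_iso K (cross_polytope_boundary (resolution_depth V (star_ideal V E)))) \<and>
    matching_number E = vertex_cover_number V E \<and>
    vertex_cover_number V E = resolution_depth V (star_ideal V E)"
proof -
  have graph: "simple_graph V E" using assms by (simp add: forest_def)
  then have fin: "finite V" by (simp add: simple_graph_def)
  let ?\<Delta> = "dominance_faces V E"
  note star = star_ideal_eq_sr_ideal[OF graph]
  have simp: "simplicial ?\<Delta>" by (rule simplicial_dominance_faces[OF fin])
  have sub: "?\<Delta> \<subseteq> Pow V" by (auto simp: dominance_faces_def)
  have finite: "finite ?\<Delta>" using sub fin by (auto intro: finite_subset)
  \<comment> \<open>The same \<open>d\<close> is the suspension depth and the size of a matching,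
    and it bounds the size of a cover; all three assertions are read off from it.\<close>
  obtain d M C where d: "iterated_suspension ?\<Delta> d" "M \<subseteq> E" "disjoint M" "card M = d"
    "C \<subseteq> V" "\<forall>e\<in>E. e \<inter> C \<noteq> {}" "card C \<le> d"
    using forest_iterated_suspension[OF assms] by blast
  have depth: "resolution_depth V (star_ideal V E) = d"
    unfolding star by (rule iterated_suspension_simple(2)[OF d(1) simp sub])
  obtain g where g: "inj_on g {1..2*d}" "face_collapse\<^sup>*\<^sup>* ?\<Delta> (cross_faces g d)"
    using iterated_suspension_collapses[OF d(1) simp finite] by blast
  have "collapses_onto (complex_of V (star_ideal V E)) (mon_of ` cross_faces g d)"
    unfolding star complex_of_sr_ideal[OF simp sub]
    using simp by (intro face_collapses_mon_of[OF g(2)]) (auto simp: simplicial_def)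
  moreover have "complex_iso (mon_of ` cross_faces g d)
      (cross_polytope_boundary (resolution_depth V (star_ideal V E)))"
    unfolding depth by (rule complex_iso_cross_faces[OF g(1)])
  moreover have "simple_ideal V (star_ideal V E)"
    unfolding star by (rule iterated_suspension_simple(1)[OF d(1) simp sub])
  moreover have "matching_number E = d" "vertex_cover_number V E = d"
    using matching_number_vertex_cover_number[OF graph d(2,3,5,6)] d(4,7) by simp_all
  ultimately show ?thesis using depth by auto
qed

end
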